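(* Let $n\ge1$. As maps from $\mathcal A(\mathbf A^{n-1})$ to $\mathcal N_n$, \[\mathrm{AST}=\mathrm{Match}\circ\widehat{\mathrm{RSK}}\circ\mathrm{Exc}^{-1}.\]
   Context: $\mathcal S_n(321)$ is the set of permutations $\pi$ of $\{1,\dots,n\}$ with no $i<j<k$ such that $\pi(i)>\pi(j)>\pi(k)$. $\mathbf A^{n-1}$ is the poset of intervals $\{[i,j]:1\le i\le j\le n-1\}$ ordered by inclusion, and $\mathcal A(\mathbf A^{n-1})$ is its set of antichains. The map $\mathrm{Exc}:\mathcal S_n(321)\to\mathcal A(\mathbf A^{n-1})$, $\mathrm{Exc}(\pi)=\{[i,\pi(i)-1]:\pi(i)>i\}$, is a bijection. $\mathcal N_n$ is the set of noncrossing perfect matchings of $\{1,\dots,2n\}$ (there are no $i<j<k<\ell$ with $i$ matched to $k$ and $j$ matched to $\ell$). The points are placed around a circle in clockwise order $1,2,\dots,2n$; write $\overline{i}$ for the point $2n+1-i$, $1\le i\le n$, so the clockwise order is $1,2,\dots,n,\overline n,\overline{n-1},\dots,\overline1$. $\mathrm{AST}:\mathcal A(\mathbf A^{n-1})\to\mathcal N_n$ (Armstrong--Stump--Thomas bijection, type $A$): given an antichain $A$, start with no matched points, and for $i=1,2,\dots,n$ in order: if $[i,j-1]\in A$ for some $j$, match the vertex $j$ with the nearest unmatched vertex in counterclockwise direction; otherwise match the vertex $\overline i$ with the nearest unmatched vertex in clockwise direction. $\mathcal D_n$ is the set of Dyck words: words with $n$ letters $\mathtt u$ and $n$ letters $\mathtt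 d$ such that every prefix has at least as many $\mathtt u$'s as $\mathtt d$'s. Viewing $\mathtt u$ and $\mathtt d$ as opening and closing parentheses, a pair of matched steps is called a tunnel. $\mathrm{Match}:\mathcal D_n\to\mathcal N_n$ matches $x$ and $y$ in $\mathrm{Match}(D)$ if and only if the steps of $D$ in positions $x$ and $y$ form a tunnel. $\mathrm{RSK}(\pi)=(P,Q)$ denotes the Robinson--Schensted--Knuth (row insertion) correspondence, with $P$ the insertion tableau and $Q$ the recording tableau; for $\pi\in\mathcal S_n(321)$ both have at most two rows. $\widehat{\mathrm{RSK}}:\mathcal S_n(321)\to\mathcal D_n$ is defined as follows: for $1\le i\le n$, the $i$th step of $\widehat{\mathrm{RSK}}(\pi)$ is $\mathtt u$ if $i$ is in the top row of $P$ and $\mathtt d$ otherwise; the $(2n+1-i)$th step is $\mathtt d$ if $i$ is in the top row of $Q$ and $\mathtt u$ otherwise. *)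

theory Defs
  imports Main "HOL-Library.FuncSet" "HOL-Library.Disjoint_Sets" "HOL-Combinatorics.Permutations"
begin

section \<open>321-avoiding permutations and antichains of intervals\<close>

definition Av321 :: "nat \<Rightarrow> (nat \<Rightarrow> nat) set" where
  "Av321 n = {\<pi>. \<pi> permutes {1..n} \<and>
     \<not> (\<exists>i j k. 1 \<le> i \<and> i < j \<and> j < k \<and> k \<le> n \<and> \<pi> i > \<pi> j \<and> \<pi> j > \<pi> k)}"

definition intervals :: "nat \<Rightarrow> nat set set" where
  "intervals m = {{i..j} | i j. 1 \<le> i \<and> i \<le> j \<and> j \<le> m}"

definition antichains :: "nat \<Rightarrow> nat set set set" where
  "antichains m = {A. A \<subseteq> intervals m \<and> (\<forall>I\<in>A. \<forall>J\<in>A. I \<subseteq> J \<longrightarrow> I = J)}"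

text \<open>For \<open>\<pi> permutes {1..n}\<close>, \<open>i < \<pi> i\<close> already forces \<open>1 \<le> i\<close> and \<open>i < n\<close>.\<close>

definition Exc :: "(nat \<Rightarrow> nat) \<Rightarrow> nat set set" where
  "Exc \<pi> = {{i..\<pi> i - 1} | i. i < \<pi> i}"

section \<open>Noncrossing matchings and the Armstrong--Stump--Thomas map\<close>

text \<open>A perfect matching is the set of its edges, each edge being a two-element set.\<close>

definition noncrossing_matchings :: "nat \<Rightarrow> nat set set set" where
  "noncrossing_matchings n = {M. partition_on {1..2 * n} M \<and> (\<forall>e\<in>M. card e = 2) \<and>
     \<not> (\<exists>i j k l. i < j \<and> j < k \<and> k < l \<and> {i, k} \<in> M \<and> {j, l} \<in> M)}"

definition bar :: "nat \<Rightarrow> nat \<Rightarrow> nat" where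
  "bar n i = 2 * n + 1 - i"

text \<open>The number of clockwise unit steps from \<open>v\<close> to \<open>w\<close>, for \<open>v, w \<in> {1..2 * n}\<close>, when
  \<open>1, ..., 2 * n\<close> are placed clockwise around a circle.\<close>

definition cw_dist :: "nat \<Rightarrow> nat \<Rightarrow> nat \<Rightarrow> nat" where
  "cw_dist n v w = (w + 2 * n - v) mod (2 * n)"

text \<open>In the following, \<open>M\<close> is the set of edges constructed so far. The vertex \<open>v\<close>
  that is about to be matched is excluded from the search.\<close>

definition unmatched :: "nat \<Rightarrow> nat set set \<Rightarrow> nat set" where
  "unmatched n M = {1..2 * n} - \<Union>M"

definition nearest_cw :: "nat \<Rightarrow> nat set set \<Rightarrow> nat \<Rightarrow> nat" where
  "nearest_cw n M v = arg_min_on (\<lambda>w. cw_dist n v w) (unmatched n M - {v})"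

definition nearest_ccw :: "nat \<Rightarrow> nat set set \<Rightarrow> nat \<Rightarrow> nat" where
  "nearest_ccw n M v = arg_min_on (\<lambda>w. cw_dist n w v) (unmatched n M - {v})"

text \<open>In an antichain at most one interval starts at \<open>i\<close>, so \<open>THE\<close> below is well defined.\<close>

definition AST_step :: "nat \<Rightarrow> nat set set \<Rightarrow> nat \<Rightarrow> nat set set \<Rightarrow> nat set set" where
  "AST_step n A i M =
     (if \<exists>j. {i..j - 1} \<in> A
      then let j = (THE j. {i..j - 1} \<in> A) in insert {j, nearest_ccw n M j} M
      else insert {bar n i, nearest_cw n M (bar n i)} M)"

definition AST :: "nat \<Rightarrow> nat set set \<Rightarrow> nat set set" where
  "AST n A = fold (AST_step n A) [1..<Suc n] {}"

section \<open>Dyck words and tunnels\<close>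

datatype step = Up | Down

definition dyck_words :: "nat \<Rightarrow> step list set" where
  "dyck_words n = {w. count_list w Up = n \<and> count_list w Down = n \<and>
     (\<forall>k\<le>length w. count_list (take k w) Down \<le> count_list (take k w) Up)}"

text \<open>An opening and a closing parenthesis are matched iff the word between them is
  balanced. Positions are counted from 1.\<close>

definition tunnel :: "step list \<Rightarrow> nat \<Rightarrow> nat \<Rightarrow> bool" where
  "tunnel w x y \<longleftrightarrow> (\<exists>a b c m. w = a @ [Up] @ b @ [Down] @ c \<and> b \<in> dyck_words m \<and>
     x = length a + 1 \<and> y = length a + length b + 2)"

definition Match :: "step list \<Rightarrow> nat set set" where
  "Match w = {{x, y} | x y. tunnel w x y}"

section \<open>The Robinson--Schensted--Knuth correspondence\<close>

text \<open>A tableau is the list of its rows, top row first. Inserting \<open>x\<close> into a row bumps the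
  leftmost entry larger than \<open>x\<close>; the second component is the bumped entry, if any.\<close>

fun row_insert :: "nat \<Rightarrow> nat list \<Rightarrow> nat list \<times> nat option" where
  "row_insert x [] = ([x], None)"
| "row_insert x (y # ys) =
     (if x < y then (x # ys, Some y)
      else let (r, b) = row_insert x ys in (y # r, b))"

text \<open>The second component is the index (from 0) of the row that receives the new box.\<close>

fun tableau_insert :: "nat \<Rightarrow> nat list list \<Rightarrow> nat list list \<times> nat" where
  "tableau_insert x [] = ([[x]], 0)"
| "tableau_insert x (r # rs) =
     (case row_insert x r of
        (r', None) \<Rightarrow> (r' # rs, 0)
      | (r', Some y) \<Rightarrow> (let (rs', k) = tableau_insert y rs in (r' # rs', Suc k)))"

definition add_box :: "nat \<Rightarrow> nat \<Rightarrow> nat list list \<Rightarrow> nat list list" where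
  "add_box k i Q = (if k < length Q then Q[k := Q ! k @ [i]] else Q @ [[i]])"

definition RSK_step ::
  "(nat \<Rightarrow> nat) \<Rightarrow> nat \<Rightarrow> nat list list \<times> nat list list \<Rightarrow> nat list list \<times> nat list list" where
  "RSK_step \<pi> i = (\<lambda>(P, Q). let (P', k) = tableau_insert (\<pi> i) P in (P', add_box k i Q))"

definition RSK :: "nat \<Rightarrow> (nat \<Rightarrow> nat) \<Rightarrow> nat list list \<times> nat list list" where
  "RSK n \<pi> = fold (RSK_step \<pi>) [1..<Suc n] ([], [])"

text \<open>Letting \<open>i\<close> run down from \<open>n\<close> to 1 in the second half puts the letter of \<open>i\<close> at
  position \<open>2 * n + 1 - i\<close>.\<close>

definition RSK_hat :: "nat \<Rightarrow> (nat \<Rightarrow> nat) \<Rightarrow> step list" where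
  "RSK_hat n \<pi> = (let (P, Q) = RSK n \<pi> in
     map (\<lambda>i. if i \<in> set (hd P) then Up else Down) [1..<Suc n] @
     map (\<lambda>i. if i \<in> set (hd Q) then Down else Up) (rev [1..<Suc n]))"

end

theory Submission
  imports Defs "HOL-Library.Infinite_Set"
begin

text \<open>
  In a 321-avoiding permutation the excedances are left-to-right maxima and the other entries
  increase and are right-to-left minima, so only excedance values are ever bumped, by values at
  non-excedance positions. Exchanging each bumped position with its bumper gives an involution
  \<open>g\<close> that determines the whole word \<open>RSK_hat n \<pi>\<close>. It also tells where every search of the
  Armstrong--Stump--Thomas map ends: in step \<open>s\<close> the partner is the value of a non-excedance
  position if \<open>g s\<close> is a non-excedance position, and the bar of an excedance position otherwise.
  This follows by counting, since \<open>g\<close> maps the steps that consumed a value (resp. a bar) so far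
  injectively to the positions of the candidates. Hence every edge created joins an \<open>Up\<close>
  to a later \<open>Down\<close>. When an edge is created, one of its two arcs has no unmatched vertex left,
  so no later edge crosses it. A noncrossing perfect matching is determined by the set of its
  smaller endpoints, so the result is \<open>Match\<close> of that word.
\<close>

section \<open>Noncrossing matchings and tunnels\<close>

lemma count_list_take_drop:
  assumes "p + r \<le> length w"
  shows "count_list (take r (drop p w)) c = card {z \<in> {p<..p + r}. w ! (z - 1) = c}"
  using assms
proof (induction r)
  case 0
  then show ?case by simp
next
  case (Suc r)
  have "take (Suc r) (drop p w) = take r (drop p w) @ [w ! (p + r)]"
    using Suc.prems by (simp add: take_Suc_conv_app_nth)
  moreover have "{z \<in> {p<..p + Suc r}. w ! (z - 1) = c} =
      {z \<in> {p<..p + r}. w ! (z - 1) = c} \<union> (if w ! (p + r) = c then {Suc (p + r)} else {})"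
    by (auto simp: le_Suc_eq)
  ultimately show ?case
    using Suc by (auto simp: card_insert_if)
qed

text \<open>If two balanced words, each followed by \<open>Down\<close>, start at the same place,
  neither can be longer: the longer one would have the shorter one together with its
  \<open>Down\<close> as a prefix, with too many \<open>Down\<close>.\<close>

lemma tunnel_unique:
  assumes "tunnel w x y" "tunnel w x y'"
  shows "y = y'"
proof -
  have *: "length b' \<le> length b"
    if "b @ [Down] @ c = b' @ [Down] @ c'" "b \<in> dyck_words m" "b' \<in> dyck_words m'"
    for b b' c c' :: "step list" and m m'
  proof (rule ccontr)
    assume "\<not> length b' \<le> length b"
    then have len: "Suc (length b) \<le> length b'" by simp
    have "take (Suc (length b)) (b' @ [Down] @ c') = b @ [Down]"
      using that(1)[symmetric] by simp
    then have "take (Suc (length b)) b' = b @ [Down]"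
      using len by simp
    then show False
      using that(2,3) len unfolding dyck_words_def by force
  qed
  obtain a b c m where 1: "w = a @ [Up] @ b @ [Down] @ c" "b \<in> dyck_words m"
      "x = length a + 1" "y = length a + length b + 2"
    using assms(1) unfolding tunnel_def by blast
  obtain a' b' c' m' where 2: "w = a' @ [Up] @ b' @ [Down] @ c'" "b' \<in> dyck_words m'"
      "x = length a' + 1" "y' = length a' + length b' + 2"
    using assms(2) unfolding tunnel_def by blast
  have "b @ [Down] @ c = b' @ [Down] @ c'"
    using 1 2 by auto
  then have "length b = length b'"
    using *[of b c b' c'] *[of b' c' b c] 1(2) 2(2) by (metis order_antisym)
  then show ?thesis using 1(3,4) 2(3,4) by simp
qed

lemma tunnel_opens:
  assumes "tunnel w x y"
  shows "1 \<le> x" "x \<le> length w" "w ! (x - 1) = Up"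
  using assms unfolding tunnel_def by (auto simp: nth_append)

lemma matching_eq_iff:
  assumes "partition_on S M" "{a, b} \<in> M" "{a, c} \<in> M"
  shows "b = c"
  using partition_onD2[OF assms(1)] assms(2,3) unfolding disjoint_def
  by (metis IntI doubleton_eq_iff empty_iff insertI1)

lemma matching_partner:
  assumes "partition_on S M" "\<forall>e\<in>M. card e = 2" "z \<in> S"
  obtains z' where "{z, z'} \<in> M" "z' \<noteq> z"
proof -
  obtain e where "e \<in> M" "z \<in> e"
    using assms(1,3) unfolding partition_on_def by blast
  then show ?thesis
    using assms(2) that by (metis card_2_iff doubleton_eq_iff insertE singletonD)
qed

text \<open>Points inside an edge are matched inside it, since \<open>M\<close> does not cross
  itself, and each \<open>Down\<close> with an earlier \<open>Up\<close>; so the factor inside is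
  balanced and every edge is a tunnel. Conversely, a tunnel starts at an \<open>Up\<close>, where an
  edge of \<open>M\<close> opens as well, and tunnels with the same start coincide.\<close>

lemma noncrossing_matching_eq_Match:
  assumes M: "M \<in> noncrossing_matchings n" and len: "length w = 2 * n"
    and orient: "\<And>x y. x < y \<Longrightarrow> {x, y} \<in> M \<Longrightarrow> w ! (x - 1) = Up \<and> w ! (y - 1) = Down"
  shows "M = Match w"
proof -
  have part: "partition_on {1..2 * n} M" and two: "\<forall>e\<in>M. card e = 2"
    and nc: "\<And>i j k l. i < j \<Longrightarrow> j < k \<Longrightarrow> k < l \<Longrightarrow> {i, k} \<in> M \<Longrightarrow> {j, l} \<notin> M"
    using M unfolding noncrossing_matchings_def by blast+
  \<comment> \<open>The partner of \<open>z\<close>; being chosen by \<open>SOME\<close>, it is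
    meaningful on \<open>{1..2 * n}\<close> only.\<close>
  define q where "q z = (SOME z'. {z, z'} \<in> M)" for z
  have q: "{z, q z} \<in> M" "q z \<noteq> z" if z: "z \<in> {1..2 * n}" for z
  proof -
    obtain z' where z': "{z, z'} \<in> M" "z' \<noteq> z"
      by (rule matching_partner[OF part two z])
    show "{z, q z} \<in> M" unfolding q_def using z'(1) by (rule someI)
    then show "q z \<noteq> z" using z' matching_eq_iff[OF part] by blast
  qed
  have inj_q: "inj_on q {1..2 * n}"
    by (rule inj_onI) (metis q(1) insert_commute matching_eq_iff[OF part])
  have q_Down: "q z < z \<and> w ! (q z - 1) = Up" if "z \<in> {1..2 * n}" "w ! (z - 1) = Down" for z
    using orient[of z "q z"] orient[of "q z" z] q[OF that(1)] that(2)
    by (metis insert_commute neq_iff step.distinct(1))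
  have q_Up: "z < q z \<and> w ! (q z - 1) = Down" if "z \<in> {1..2 * n}" "w ! (z - 1) = Up" for z
    using orient[of z "q z"] orient[of "q z" z] q[OF that(1)] that(2)
    by (metis insert_commute neq_iff step.distinct(1))
  have sub: "z \<in> {1..2 * n}" if "{z, z'} \<in> M" for z z'
    using part that unfolding partition_on_def by blast
  have tun: "tunnel w x y" if xy: "x < y" "{x, y} \<in> M" for x y
  proof -
    have x: "1 \<le> x" and y: "y \<le> 2 * n"
      using sub[of x y] sub[of y x] xy by (auto simp: insert_commute)
    have inside: "q z \<in> {x<..<y}" if z: "z \<in> {x<..<y}" for z
    proof -
      have z': "z \<in> {1..2 * n}" using z x y by auto
      have "q z \<noteq> x" "q z \<noteq> y"
        using q(1)[OF z'] xy z matching_eq_iff[OF part, of x y z] matching_eq_iff[OF part, of y x z]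
        by (metis greaterThanLessThan_iff insert_commute less_irrefl)+
      moreover have "\<not> q z < x"
        using nc[of "q z" x z y] q(1)[OF z'] xy z by (metis greaterThanLessThan_iff insert_commute)
      moreover have "\<not> q z > y"
        using nc[of x z y "q z"] q(1)[OF z'] xy z by (metis greaterThanLessThan_iff)
      ultimately show ?thesis by auto
    qed
    define b where "b = take (y - x - 1) (drop x w)"
    define N where "N r c = card {z \<in> {x<..x + r}. w ! (z - 1) = c}" for r c
    have count: "count_list (take r b) c = N r c" if "r \<le> y - x - 1" for r c
      using count_list_take_drop[of x r w c] that xy(1) y len
      unfolding b_def N_def by (simp add: min_def)
    \<comment> \<open>The partner of a \<open>Down\<close> lies further left but still to the right
      of \<open>x\<close>, hence in the same prefix.\<close>
    have le: "N r Down \<le> N r Up" if "r \<le> y - x - 1" for r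
      unfolding N_def
    proof (rule card_inj_on_le)
      show "inj_on q {z \<in> {x<..x + r}. w ! (z - 1) = Down}"
        using inj_q by (rule inj_on_subset) (use that x y in auto)
      show "q ` {z \<in> {x<..x + r}. w ! (z - 1) = Down} \<subseteq> {z \<in> {x<..x + r}. w ! (z - 1) = Up}"
      proof safe
        fix z assume z: "z \<in> {x<..x + r}" "w ! (z - 1) = Down"
        then have "z \<in> {x<..<y}" "z \<in> {1..2 * n}" using that x y by auto
        with z q_Down[of z] inside[of z]
        show "q z \<in> {x<..x + r}" "w ! (q z - 1) = Up"
          by auto
      qed
    qed auto
    \<comment> \<open>The partner of an \<open>Up\<close> lies further right and may leave a prefix,
      but it never leaves the whole factor between \<open>x\<close> and \<open>y\<close>.\<close>
    have ge: "N (y - x - 1) Up \<le> N (y - x - 1) Down"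
      unfolding N_def
    proof (rule card_inj_on_le)
      let ?I = "{x<..x + (y - x - 1)}"
      show "inj_on q {z \<in> ?I. w ! (z - 1) = Up}"
        using inj_q by (rule inj_on_subset) (use x y in auto)
      show "q ` {z \<in> ?I. w ! (z - 1) = Up} \<subseteq> {z \<in> ?I. w ! (z - 1) = Down}"
      proof safe
        fix z assume z: "z \<in> ?I" "w ! (z - 1) = Up"
        then have "z \<in> {x<..<y}" "z \<in> {1..2 * n}" using x y by auto
        with z q_Up[of z] inside[of z]
        show "q z \<in> ?I" "w ! (q z - 1) = Down"
          by auto
      qed
    qed auto
    have lenb: "length b = y - x - 1" using len y unfolding b_def by simp
    have "b \<in> dyck_words (N (y - x - 1) Up)"
      unfolding dyck_words_def
      using count[of "y - x - 1"] le_antisym[OF le[of "y - x - 1"] ge] count le lenb by auto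
    moreover have "w = take (x - 1) w @ [Up] @ b @ [Down] @ drop y w"
    proof -
      have "w = take (x - 1) w @ w ! (x - 1) # drop x w"
        using id_take_nth_drop[of "x - 1" w] x xy(1) y len by simp
      moreover have "drop x w = b @ drop (y - 1) w"
        using append_take_drop_id[of "y - x - 1" "drop x w"] xy(1) unfolding b_def by simp
      moreover have "drop (y - 1) w = w ! (y - 1) # drop y w"
        using Cons_nth_drop_Suc[of "y - 1" w] xy(1) y len by simp
      ultimately show ?thesis using orient[OF xy] by simp
    qed
    ultimately show ?thesis
      unfolding tunnel_def using x xy(1) y len lenb
      by (intro exI[of _ "take (x - 1) w"] exI[of _ b] exI[of _ "drop y w"] exI conjI) auto
  qed
  show ?thesis
  proof (intro equalityI subsetI)
    fix e assume e: "e \<in> M"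
    then obtain x y where "e = {x, y}" "x \<noteq> y"
      using two by (metis card_2_iff)
    then obtain x y where "e = {x, y}" "x < y"
      by (metis insert_commute neq_iff)
    then show "e \<in> Match w" using tun e unfolding Match_def by blast
  next
    fix e assume "e \<in> Match w"
    then obtain x y where e: "e = {x, y}" "tunnel w x y" unfolding Match_def by blast
    have x: "x \<in> {1..2 * n}" using tunnel_opens[OF e(2)] len by simp
    have "y = q x" using tunnel_unique[OF e(2) tun] q_Up[OF x tunnel_opens(3)[OF e(2)]] q(1)[OF x] by blast
    then show "e \<in> M" using q(1)[OF x] e by simp
  qed
qed

section \<open>The top rows of the tableaux\<close>

text \<open>In a strictly increasing row the leftmost entry larger than \<open>x\<close> is the
  least such entry, so insertion can be described by sets alone.\<close>

lemma row_insert_strict_sorted: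
  assumes "sorted_wrt (<) r" "x \<notin> set r"
  shows "sorted_wrt (<) (fst (row_insert x r)) \<and>
    set (fst (row_insert x r)) =
      insert x (set r - (if \<exists>y\<in>set r. x < y then {Min {y \<in> set r. x < y}} else {})) \<and>
    (snd (row_insert x r) = None \<longleftrightarrow> \<not> (\<exists>y\<in>set r. x < y))"
  using assms
proof (induction r)
  case Nil
  then show ?case by simp
next
  case (Cons a r)
  show ?case
  proof (cases "x < a")
    case True
    then have "Min {y \<in> set (a # r). x < y} = a"
      using Cons.prems by (intro Min_eqI) auto
    then show ?thesis using True Cons.prems by auto
  next
    case False
    then have eq: "{y \<in> set (a # r). x < y} = {y \<in> set r. x < y}" and "a < x"
      using Cons.prems by auto
    have IH: "sorted_wrt (<) (fst (row_insert x r))"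
      "set (fst (row_insert x r)) =
        insert x (set r - (if \<exists>y\<in>set r. x < y then {Min {y \<in> set r. x < y}} else {}))"
      "snd (row_insert x r) = None \<longleftrightarrow> \<not> (\<exists>y\<in>set r. x < y)"
      using Cons by auto
    have "Min {y \<in> set r. x < y} \<noteq> a" if "\<exists>y\<in>set r. x < y"
      using Min_in[of "{y \<in> set r. x < y}"] that False by force
    then show ?thesis
      unfolding eq using IH False Cons.prems \<open>a < x\<close>
      by (auto simp: case_prod_unfold split: if_splits)
  qed
qed

text \<open>The first row of the insertion tableau as a bare set: the row is sorted, so the set
  determines it, and the letters of \<open>RSK_hat\<close> depend on nothing below it.\<close>

primrec top_row :: "(nat \<Rightarrow> nat) \<Rightarrow> nat \<Rightarrow> nat set" where
  "top_row p 0 = {}"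
| "top_row p (Suc i) = insert (p (Suc i)) (top_row p i -
     (if \<exists>y\<in>top_row p i. p (Suc i) < y then {Min {y \<in> top_row p i. p (Suc i) < y}} else {}))"

text \<open>For \<open>k = 0\<close> the truncated \<open>k - 1\<close> yields the empty row, so
  position 0 never bumps.\<close>

definition bumps :: "(nat \<Rightarrow> nat) \<Rightarrow> nat \<Rightarrow> bool" where
  "bumps p k \<longleftrightarrow> (\<exists>y\<in>top_row p (k - 1). p k < y)"

definition bumped :: "(nat \<Rightarrow> nat) \<Rightarrow> nat \<Rightarrow> nat" where
  "bumped p k = Min {y \<in> top_row p (k - 1). p k < y}"

lemma top_row_Suc:
  "top_row p (Suc i) = insert (p (Suc i))
     (top_row p i - (if bumps p (Suc i) then {bumped p (Suc i)} else {}))"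
  by (simp add: bumps_def bumped_def)

lemma top_row_subset: "top_row p i \<subseteq> p ` {1..i}"
proof (induction i)
  case (Suc i)
  then show ?case by (force simp: top_row_Suc simp del: top_row.simps)
qed simp

lemma finite_top_row [simp]: "finite (top_row p i)"
  using top_row_subset by (rule finite_subset) simp

lemma bumpedD:
  assumes "bumps p k"
  shows "bumped p k \<in> top_row p (k - 1)" "p k < bumped p k"
    and "\<And>y. y \<in> top_row p (k - 1) \<Longrightarrow> p k < y \<Longrightarrow> bumped p k \<le> y"
proof -
  have "bumped p k \<in> {y \<in> top_row p (k - 1). p k < y}"
    unfolding bumped_def using assms by (intro Min_in) (auto simp: bumps_def)
  then show "bumped p k \<in> top_row p (k - 1)" "p k < bumped p k" by auto
  show "bumped p k \<le> y" if "y \<in> top_row p (k - 1)" "p k < y" for y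
    unfolding bumped_def using that by (intro Min_le) auto
qed

lemma bumpedE:
  assumes "bumps p k"
  obtains e where "1 \<le> e" "e < k" "bumped p k = p e" "p k < p e"
proof -
  have "bumped p k \<in> p ` {1..k - 1}"
    using bumpedD(1)[OF assms] top_row_subset by blast
  then obtain e where "e \<in> {1..k - 1}" "bumped p k = p e" by blast
  then show ?thesis using that[of e] bumpedD(2)[OF assms] by auto
qed

text \<open>By injectivity each value enters the row only once, so a value that has been bumped
  never comes back.\<close>

lemma mem_top_row_iff:
  assumes "inj p"
  shows "v \<in> top_row p i \<longleftrightarrow> v \<in> p ` {1..i} \<and> \<not> (\<exists>k\<in>{1..i}. bumps p k \<and> bumped p k = v)"
proof (induction i)
  case (Suc i)
  \<comment> \<open>A bumped value belongs to a position before its bumper, so the value just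
    inserted cannot have been bumped yet.\<close>
  have new: "\<not> (\<exists>k\<in>{1..Suc i}. bumps p k \<and> bumped p k = p (Suc i))"
  proof safe
    fix k assume k: "k \<in> {1..Suc i}" "bumps p k" "bumped p k = p (Suc i)"
    from k(2) obtain e where "e < k" "bumped p k = p e" by (rule bumpedE)
    then show False using k injD[OF assms, of e "Suc i"] by simp
  qed
  show ?case
  proof (cases "v = p (Suc i)")
    case True
    then show ?thesis using new by simp
  next
    case False
    then show ?thesis
      using Suc.IH unfolding top_row_Suc by (auto simp: atLeastAtMostSuc_conv)
  qed
qed simp

text \<open>The induction starts at 1, because before the first insertion both tableaux are empty
  and have no first row.\<close>

lemma RSK_top_rows:
  assumes "inj p" "1 \<le> i"
  shows "fst (RSK i p) \<noteq> [] \<and> snd (RSK i p) \<noteq> [] \<and> sorted_wrt (<) (hd (fst (RSK i p))) \<and>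
    set (hd (fst (RSK i p))) = top_row p i \<and> set (hd (snd (RSK i p))) = {k \<in> {1..i}. \<not> bumps p k}"
  using assms(2)
proof (induction rule: nat_induct_at_least)
  case base
  then show ?case
    by (auto simp: RSK_def RSK_step_def add_box_def bumps_def)
next
  case (Suc i)
  obtain P Q where PQ: "RSK i p = (P, Q)" by fastforce
  have IH: "P \<noteq> []" "Q \<noteq> []" "sorted_wrt (<) (hd P)" "set (hd P) = top_row p i"
      "set (hd Q) = {k \<in> {1..i}. \<not> bumps p k}"
    using Suc.IH PQ by auto
  have step: "RSK (Suc i) p = RSK_step p (Suc i) (P, Q)"
    using PQ by (simp add: RSK_def)
  obtain r rs where P: "P = r # rs" using IH(1) by (cases P) auto
  obtain r' bo where ins: "row_insert (p (Suc i)) r = (r', bo)" by fastforce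
  have "p (Suc i) \<notin> set r"
    using IH(4) P top_row_subset[of p i] injD[OF assms(1)] by fastforce
  with row_insert_strict_sorted[of r "p (Suc i)"] IH(3,4) P ins
  have r': "sorted_wrt (<) r'" "set r' = top_row p (Suc i)" "bo = None \<longleftrightarrow> \<not> bumps p (Suc i)"
    by (auto simp: bumps_def)
  \<comment> \<open>After a bump the new box lies in a lower row, of index \<open>Suc k\<close>, and
    the first row of \<open>Q\<close> stays as it is; without a bump the box extends that
    row.\<close>
  have hdQ: "hd (add_box (Suc k) (Suc i) Q) = hd Q" "add_box (Suc k) (Suc i) Q \<noteq> []" for k
    using IH(2) by (auto simp: add_box_def hd_append neq_Nil_conv)
  have hdQ0: "hd (add_box 0 (Suc i) Q) = hd Q @ [Suc i]" "add_box 0 (Suc i) Q \<noteq> []"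
    using IH(2) by (auto simp: add_box_def neq_Nil_conv)
  show ?case
  proof (cases bo)
    case None
    then show ?thesis
      using r' hdQ0 IH(5) by (auto simp: step RSK_step_def P ins le_Suc_eq simp del: top_row.simps)
  next
    case (Some y)
    then show ?thesis
      using r' hdQ IH(5) by (auto simp: step RSK_step_def P ins le_Suc_eq case_prod_unfold Let_def
        simp del: top_row.simps)
  qed
qed

lemma RSK_hat_nth:
  assumes "inj p" "1 \<le> n"
  shows "length (RSK_hat n p) = 2 * n"
    and "v \<in> {1..n} \<Longrightarrow> RSK_hat n p ! (v - 1) = (if v \<in> top_row p n then Up else Down)"
    and "k \<in> {1..n} \<Longrightarrow> RSK_hat n p ! (bar n k - 1) = (if bumps p k then Up else Down)"
proof -
  obtain P Q where PQ: "RSK n p = (P, Q)" by fastforce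
  have top: "set (hd P) = top_row p n" "set (hd Q) = {k \<in> {1..n}. \<not> bumps p k}"
    using RSK_top_rows[OF assms] PQ by auto
  have w: "RSK_hat n p = map (\<lambda>i. if i \<in> top_row p n then Up else Down) [1..<Suc n] @
     map (\<lambda>i. if i \<in> {1..n} \<and> \<not> bumps p i then Down else Up) (rev [1..<Suc n])"
    using PQ top by (simp add: RSK_hat_def)
  show "length (RSK_hat n p) = 2 * n"
    unfolding w by simp
  show "RSK_hat n p ! (v - 1) = (if v \<in> top_row p n then Up else Down)" if "v \<in> {1..n}"
  proof -
    have "v - 1 < n" using that by auto
    then show ?thesis
      unfolding w using that by (simp add: nth_append del: upt_Suc)
  qed
  show "RSK_hat n p ! (bar n k - 1) = (if bumps p k then Up else Down)" if "k \<in> {1..n}"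
  proof -
    \<comment> \<open>The letter of the point \<open>bar n k\<close> has list index
      \<open>2 * n - k\<close>, which is index \<open>n - k\<close> in the reversed second
      half.\<close>
    have "rev [1..<Suc n] ! (n - k) = k"
      using that by (simp add: rev_nth del: upt_Suc)
    moreover have "\<not> bar n k - 1 < n" "bar n k - 1 - n = n - k" "n - k < n"
      using that by (auto simp: bar_def)
    ultimately show ?thesis
      unfolding w using that by (simp add: nth_append del: upt_Suc)
  qed
qed

section \<open>Bumping in 321-avoiding permutations\<close>

locale perm321 =
  fixes n :: nat and p :: "nat \<Rightarrow> nat"
  assumes Av: "p \<in> Av321 n"
begin

section \<open>Inversions, excedances and the bumping involution\<close>

lemma permutes: "p permutes {1..n}"
  and avoids: "1 \<le> i \<Longrightarrow> i < j \<Longrightarrow> j < k \<Longrightarrow> k \<le> n \<Longrightarrow> p i > p j \<Longrightarrow> p j > p k \<Longrightarrow> False"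
  using Av unfolding Av321_def by blast+

lemma inj: "inj p"
  using permutes by (rule permutes_inj)

lemma p_eq_iff [simp]: "p i = p j \<longleftrightarrow> i = j"
  using inj by (rule inj_eq)

lemma p_in_iff [simp]: "p i \<in> {1..n} \<longleftrightarrow> i \<in> {1..n}"
  using permutes by (rule permutes_in_image)

text \<open>Values left of \<open>i\<close> lie below \<open>p i\<close>, or they would start a 321
  pattern ending in \<open>i\<close>, \<open>j\<close>. Together with \<open>p j\<close> these are
  \<open>i\<close> values in \<open>{1..<p i}\<close>. Dually, \<open>p i\<close> and the values
  right of \<open>j\<close> all exceed \<open>p j\<close>.\<close>

lemma inversion_exc:
  assumes "1 \<le> i" "i < j" "j \<le> n" "p j < p i"
  shows "i < p i" "p j < j"
proof -
  have "insert (p j) (p ` {1..<i}) \<subseteq> {1..<p i}"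
  proof -
    have "p k < p i" if "k \<in> {1..<i}" for k
      using avoids[of k i j] that assms by (metis atLeastLessThan_iff nat_neq_iff p_eq_iff)
    moreover have "1 \<le> p k" if "k \<in> {1..n}" for k
      using p_in_iff[of k] that by auto
    ultimately show ?thesis using assms by auto
  qed
  then have "card (insert (p j) (p ` {1..<i})) \<le> p i - 1"
    using card_mono[of "{1..<p i}"] by fastforce
  then show "i < p i"
    using assms by (auto simp: card_insert_if card_image inj_on_def split: if_splits)
  have "insert (p i) (p ` {j<..n}) \<subseteq> {p j<..n}"
  proof -
    have "p j < p k" if "k \<in> {j<..n}" for k
      using avoids[of i j k] that assms by (metis greaterThanAtMost_iff nat_neq_iff p_eq_iff)
    moreover have "p k \<le> n" if "k \<in> {1..n}" for k
      using p_in_iff[of k] that by auto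
    ultimately show ?thesis using assms by auto
  qed
  then have "card (insert (p i) (p ` {j<..n})) \<le> n - p j"
    using card_mono[of "{p j<..n}"] by fastforce
  then show "p j < j"
    using assms by (auto simp: card_insert_if card_image inj_on_def split: if_splits)
qed

definition E :: "nat set" where
  "E = {i. i < p i}"

lemma E_range: "i \<in> E \<Longrightarrow> 1 \<le> i" "i \<in> E \<Longrightarrow> i \<le> n"
  using permutes unfolding E_def permutes_def by (metis (mono_tags) atLeastAtMost_iff less_irrefl mem_Collect_eq)+

text \<open>A larger earlier value would form an inversion, and the right end of an inversion is no
  excedance.\<close>

lemma exc_left_max: "i \<in> E \<Longrightarrow> 1 \<le> e \<Longrightarrow> e < i \<Longrightarrow> p e < p i"
  using inversion_exc(2)[of e i] E_range(2)[of i] unfolding E_def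
  by (metis mem_Collect_eq nat_neq_iff order_less_asym p_eq_iff)

text \<open>Dually, the left end of an inversion is an excedance.\<close>

lemma nonexc_right_min: "1 \<le> i \<Longrightarrow> i \<notin> E \<Longrightarrow> i < k \<Longrightarrow> k \<le> n \<Longrightarrow> p i < p k"
  using inversion_exc(1)[of i k] unfolding E_def
  by (metis mem_Collect_eq nat_neq_iff p_eq_iff)

lemma bump_exc:
  assumes "bumps p k" "k \<le> n"
  obtains e where "e \<in> E" "k \<notin> E" "e < k" "bumped p k = p e" "p k < p e"
proof -
  obtain e where e: "1 \<le> e" "e < k" "bumped p k = p e" "p k < p e"
    using assms(1) by (rule bumpedE)
  then show ?thesis
    using that inversion_exc[of e k] assms(2) unfolding E_def by auto
qed

text \<open>The later bump would need the value in a row from which the earlier bump has already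
  removed it.\<close>

lemma bumped_inj:
  assumes "bumps p k" "bumps p k'" "bumped p k = bumped p k'"
  shows "k = k'"
proof -
  have "\<not> k < k'" if "bumps p k" "bumps p k'" "bumped p k = bumped p k'" for k k'
  proof
    assume "k < k'"
    moreover have "1 \<le> k" using that(1) by (cases k) (auto simp: bumps_def)
    ultimately show False
      using bumpedD(1)[OF that(2)] mem_top_row_iff[OF inj, of "bumped p k'" "k' - 1"] that by auto
  qed
  from this[of k k'] this[of k' k] assms show ?thesis by auto
qed

text \<open>Exchanges the position of a bumped value with the position of its bumper.\<close>

definition g :: "nat \<Rightarrow> nat" where
  "g x = (if bumps p x then inv p (bumped p x)
     else if \<exists>k\<le>n. bumps p k \<and> bumped p k = p x then THE k. bumps p k \<and> bumped p k = p x
     else x)"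

lemma g_bumper:
  assumes "bumps p k" "k \<le> n"
  shows "g k \<in> E" "k \<notin> E" "g k < k" "bumped p k = p (g k)" "p k < p (g k)"
proof -
  obtain e where "e \<in> E" "k \<notin> E" "e < k" "bumped p k = p e" "p k < p e"
    using assms by (rule bump_exc)
  moreover from this have "g k = e"
    unfolding g_def using assms(1) inj by (simp add: inv_f_f)
  ultimately show "g k \<in> E" "k \<notin> E" "g k < k" "bumped p k = p (g k)" "p k < p (g k)" by auto
qed

lemma g_bumped:
  assumes "bumps p k" "k \<le> n" "bumped p k = p e"
  shows "g e = k" "e = g k"
proof -
  show e: "e = g k" using g_bumper(4)[OF assms(1,2)] assms(3) by simp
  \<comment> \<open>Excedances never bump, so the first branch of \<open>g\<close> is not taken at
    \<open>e\<close>.\<close>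
  have "\<not> bumps p e"
    using g_bumper(1,3)[OF assms(1,2)] g_bumper(2)[of e] assms(2) e by auto
  moreover have "(THE k. bumps p k \<and> bumped p k = p e) = k"
    using assms bumped_inj by (intro the_equality) auto
  ultimately show "g e = k" unfolding g_def using assms by auto
qed

text \<open>Elimination rule collecting what is known in each of three situations: \<open>x\<close>
  bumps, \<open>x\<close> gets bumped, or neither. Most later arguments access \<open>g\<close>
  through it.\<close>

lemma g_cases [case_names bumper bumped fixed]:
  assumes "x \<le> n"
  obtains "bumps p x" "x \<notin> E" "g x \<in> E" "g x < x" "p x < p (g x)" "g (g x) = x"
  | "bumps p (g x)" "bumped p (g x) = p x" "x \<in> E" "g x \<notin> E" "g x \<le> n" "x < g x" "p (g x) < p x"
      "g (g x) = x"
  | "g x = x" "\<not> bumps p x" "\<And>k. k \<le> n \<Longrightarrow> bumps p k \<Longrightarrow> bumped p k \<noteq> p x"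
proof (cases "bumps p x")
  case True
  then show ?thesis
    using that(1) g_bumper[OF True assms] g_bumped(1)[OF True assms] by blast
next
  case nb: False
  show ?thesis
  proof (cases "\<exists>k\<le>n. bumps p k \<and> bumped p k = p x")
    case True
    then obtain k where k: "k \<le> n" "bumps p k" "bumped p k = p x" by blast
    then have "g x = k" "x = g k" using g_bumped[of k x] by auto
    then show ?thesis using that(2) g_bumper[OF k(2,1)] k by auto
  next
    case False
    have "g x = x" unfolding g_def if_not_P[OF nb] if_not_P[OF False] ..
    then show ?thesis using that(3) nb False by blast
  qed
qed

lemma g_g: "x \<le> n \<Longrightarrow> g (g x) = x"
  by (erule g_cases) auto

lemma g_range:
  assumes "x \<in> {1..n}"
  shows "g x \<in> {1..n}"
proof -
  have "x \<le> n" using assms by simp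
  then show ?thesis
    using assms E_range[of "g x"] by (cases rule: g_cases) auto
qed

lemma inj_on_g: "inj_on g {1..n}"
  by (rule inj_on_inverseI[of _ g]) (auto simp: g_g)

lemma bumps_iff:
  assumes "k \<in> {1..n}"
  shows "bumps p k \<longleftrightarrow> k \<notin> E \<and> g k \<in> E"
proof -
  have "k \<le> n" using assms by simp
  then show ?thesis by (cases rule: g_cases) (use g_bumper[of k] in auto)
qed

text \<open>Together with \<open>bumps_iff\<close> this turns all letters of \<open>RSK_hat\<close>
  into conditions on \<open>E\<close> and \<open>g\<close>.\<close>

lemma top_row_iff:
  assumes "e \<in> {1..n}"
  shows "p e \<in> top_row p n \<longleftrightarrow> \<not> (e \<in> E \<and> g e \<notin> E)"
proof -
  have "e \<le> n" using assms by simp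
  then show ?thesis
  proof (cases rule: g_cases)
    case bumper
    then have "bumped p k \<noteq> p e" if "bumps p k" "k \<le> n" for k
      using g_bumped(2)[OF that, of e] g_bumper(1)[OF that] by blast
    then show ?thesis using bumper assms by (auto simp: mem_top_row_iff[OF inj])
  next
    case bumped
    then have "g e \<in> {1..n}" by auto
    then show ?thesis using bumped assms by (auto simp: mem_top_row_iff[OF inj])
  next
    case fixed
    then show ?thesis using assms by (auto simp: mem_top_row_iff[OF inj])
  qed
qed

text \<open>Here \<open>e\<close> is an excedance that is never bumped, so \<open>p e\<close> is
  still in the row when \<open>p i\<close> arrives. Hence \<open>i\<close> bumps a value smaller
  than \<open>p e\<close>, and excedance values increase with their positions.\<close>

lemma larger_unbumped:
  assumes "e \<in> E" "g e \<in> E" "e < i" "i \<le> n" "p i < p e"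
  shows "g i < e"
proof -
  have e: "1 \<le> e" "e \<le> n" using E_range assms(1) by auto
  have ne: "bumped p k \<noteq> p e" if "bumps p k" "k \<le> n" for k
    using g_bumped(1)[OF that, of e] g_bumper(2)[OF that] that(1) assms(2) by blast
  have mem: "p e \<in> top_row p (i - 1)"
    using ne e assms(3,4) by (auto simp: mem_top_row_iff[OF inj])
  then have b: "bumps p i" using assms(5) unfolding bumps_def by auto
  have "p (g i) < p e"
    using bumpedD(3)[OF b mem assms(5)] ne[OF b assms(4)] g_bumper(4)[OF b assms(4)]
    by (simp add: order_less_le)
  moreover have "g i \<in> E" using g_bumper(1)[OF b assms(4)] .
  ultimately show "g i < e"
    using exc_left_max[of "g i" e] e by (metis nat_neq_iff order_less_asym)
qed

text \<open>As \<open>i\<close> bumps nothing, a larger value inserted earlier must have left the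
  row before, and \<open>g e\<close> is the position that bumped it.\<close>

lemma larger_nonbumper:
  assumes "i \<notin> E" "g i \<notin> E" "1 \<le> e" "e < i" "i \<le> n" "p i < p e"
  shows "g e < i"
proof -
  have nb: "\<not> bumps p i" using g_bumper assms by blast
  then have "p e \<notin> top_row p (i - 1)" using assms(6) unfolding bumps_def by auto
  then obtain k where k: "k \<in> {1..i - 1}" "bumps p k" "bumped p k = p e"
    using assms by (auto simp: mem_top_row_iff[OF inj])
  then show "g e < i"
    using g_bumped(1)[of k e] assms by auto
qed

text \<open>Shows that \<open>p \<circ> g\<close> sends the steps that consume a value to candidates
  within reach of step \<open>s\<close>. If \<open>s\<close> is an excedance, \<open>p s\<close> is
  a left-to-right maximum and passing from \<open>x\<close> to \<open>g x\<close> does not raise the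
  value. Otherwise, if \<open>x\<close> is bumped and \<open>p x\<close> exceeds \<open>p s\<close>,
  its bumper precedes \<open>s\<close>, and values off \<open>E\<close> increase.\<close>

lemma value_steps_bound:
  assumes "s \<in> {1..n}" "g s \<notin> E" "x \<in> {1..s}" "g x \<notin> E"
  shows "p (g x) \<le> p s"
proof (cases "s \<in> E")
  case True
  have "p x \<le> p s" using exc_left_max[OF True, of x] assms(3) by (cases "x = s") auto
  moreover have "x \<le> n" using assms by simp
  then have "p (g x) \<le> p x" using assms(4) by (cases rule: g_cases) auto
  ultimately show ?thesis by simp
next
  case False
  have "x \<le> n" using assms by simp
  then show ?thesis
  proof (cases rule: g_cases)
    case bumper
    then show ?thesis using assms by simp
  next
    case bumped
    show ?thesis
    proof (cases "p s < p x")
      case True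
      have "x < s" using True assms(3) by (cases "x = s") auto
      then have "g x < s" using larger_nonbumper[of s x] False assms True by auto
      then show ?thesis using nonexc_right_min[of "g x" s] bumped assms g_range[of x] by auto
    qed (use bumped in auto)
  next
    case fixed
    then show ?thesis using nonexc_right_min[of x s] assms by (cases "x = s") auto
  qed
qed

text \<open>Serves to show that at such a step \<open>s\<close> the bars of all earlier excedances
  are taken. If \<open>p e\<close> is not above \<open>p s\<close>, a bumper of \<open>e\<close> has
  a still smaller value and so precedes \<open>s\<close>, as values off \<open>E\<close>
  increase.\<close>

lemma exc_before_nonbumper:
  assumes "s \<in> {1..n}" "s \<notin> E" "g s \<notin> E" "e \<in> E" "e < s"
  shows "g e < s"
proof -
  have e: "1 \<le> e" "e \<le> n" using E_range assms(4) by auto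
  show ?thesis
  proof (cases "p s < p e")
    case True
    then show ?thesis using larger_nonbumper[of s e] assms e by auto
  next
    case False
    from e(2) show ?thesis
    proof (cases rule: g_cases)
      case bumper
      then show ?thesis using assms by simp
    next
      case bumped
      show ?thesis
      proof (rule ccontr)
        assume "\<not> g e < s"
        then have "p s \<le> p (g e)"
          using nonexc_right_min[of s "g e"] bumped assms by (cases "g e = s") auto
        then show False using bumped False by simp
      qed
    next
      case fixed
      then show ?thesis using assms by simp
    qed
  qed
qed

lemma bar_steps_bound:
  assumes "x \<le> n" "g x \<in> E"
  shows "g x \<le> x"
  using assms by (cases x rule: g_cases) auto

text \<open>The counterpart for values: at an unbumped excedance \<open>s\<close> all smaller values
  off \<open>E\<close> are taken. Positions after \<open>s\<close> fall under
  \<open>larger_unbumped\<close>; those before \<open>s\<close> are fixed by \<open>g\<close> or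
  bump an earlier position.\<close>

lemma nonexc_below_unbumped:
  assumes "s \<in> E" "g s \<in> E" "k \<in> {1..n}" "k \<notin> E" "p k < p s"
  shows "g k < s"
proof (cases "s < k")
  case True
  then show ?thesis using larger_unbumped[of s k] assms by auto
next
  case False
  then have "k < s" using assms(1,4) by (cases "k = s") auto
  moreover have "g k \<le> k"
  proof -
    have "k \<le> n" using assms(3) by simp
    then show ?thesis using assms(4) by (cases rule: g_cases) auto
  qed
  ultimately show ?thesis by simp
qed

end

section \<open>The Armstrong--Stump--Thomas map\<close>

lemma arg_min_on_eqI:
  fixes f :: "'a \<Rightarrow> nat"
  assumes "w \<in> S" "\<And>x. x \<in> S \<Longrightarrow> x \<noteq> w \<Longrightarrow> f w < f x"
  shows "arg_min_on f S = w"
  unfolding arg_min_on_def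
  using arg_min_natI[of "\<lambda>x. x \<in> S" w f] arg_min_nat_le[of "\<lambda>x. x \<in> S" w f] assms
  by (meson leD)

lemma cw_dist_eq:
  assumes "v \<in> {1..2 * n}" "w \<in> {1..2 * n}"
  shows "cw_dist n v w = (if v \<le> w then w - v else w + 2 * n - v)"
proof (cases "v \<le> w")
  case True
  then have "w + 2 * n - v = (w - v) + 2 * n" by simp
  then have "cw_dist n v w = (w - v) mod (2 * n)" unfolding cw_dist_def by simp
  then show ?thesis using True assms by simp
qed (use assms in \<open>auto simp: cw_dist_def\<close>)

text \<open>The two alternatives distinguish whether the search reaches \<open>w\<close> directly or
  after passing from 1 to \<open>2 * n\<close>.\<close>

lemma nearest_ccw_eq:
  assumes "v \<in> {1..2 * n}" "w \<in> {1..2 * n} - \<Union>M"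
    and "w < v \<and> {w<..<v} \<subseteq> \<Union>M \<or> v < w \<and> {1..<v} \<union> {w<..2 * n} \<subseteq> \<Union>M"
  shows "nearest_ccw n M v = w"
  unfolding nearest_ccw_def unmatched_def
proof (rule arg_min_on_eqI)
  show "w \<in> {1..2 * n} - \<Union>M - {v}" using assms by auto
  fix x assume x: "x \<in> {1..2 * n} - \<Union>M - {v}" "x \<noteq> w"
  then have "x \<in> {1..2 * n}" "w \<in> {1..2 * n}" using assms(2) by auto
  moreover have "w < v \<and> (x < w \<or> v < x) \<or> v < w \<and> v < x \<and> x < w"
    using assms(3)
  proof
    assume "w < v \<and> {w<..<v} \<subseteq> \<Union>M"
    moreover from this have "x \<notin> {w<..<v}" using x(1) by blast
    ultimately show ?thesis using x by auto
  next
    assume "v < w \<and> {1..<v} \<union> {w<..2 * n} \<subseteq> \<Union>M"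
    moreover from this have "x \<notin> {1..<v}" "x \<notin> {w<..2 * n}" using x(1) by blast+
    ultimately show ?thesis using x by auto
  qed
  ultimately show "cw_dist n w v < cw_dist n x v"
    using assms(1) by (auto simp: cw_dist_eq)
qed

lemma nearest_cw_eq:
  assumes "v \<in> {1..2 * n}" "w \<in> {1..2 * n} - \<Union>M"
    and "v < w \<and> {v<..<w} \<subseteq> \<Union>M \<or> w < v \<and> {1..<w} \<union> {v<..2 * n} \<subseteq> \<Union>M"
  shows "nearest_cw n M v = w"
  unfolding nearest_cw_def unmatched_def
proof (rule arg_min_on_eqI)
  show "w \<in> {1..2 * n} - \<Union>M - {v}" using assms by auto
  fix x assume x: "x \<in> {1..2 * n} - \<Union>M - {v}" "x \<noteq> w"
  then have "x \<in> {1..2 * n}" "w \<in> {1..2 * n}" using assms(2) by auto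
  moreover have "v < w \<and> (x < v \<or> w < x) \<or> w < v \<and> w < x \<and> x < v"
    using assms(3)
  proof
    assume "v < w \<and> {v<..<w} \<subseteq> \<Union>M"
    moreover from this have "x \<notin> {v<..<w}" using x(1) by blast
    ultimately show ?thesis using x by auto
  next
    assume "w < v \<and> {1..<w} \<union> {v<..2 * n} \<subseteq> \<Union>M"
    moreover from this have "x \<notin> {1..<w}" "x \<notin> {v<..2 * n}" using x(1) by blast+
    ultimately show ?thesis using x by auto
  qed
  ultimately show "cw_dist n v w < cw_dist n v x"
    using assms(1) by (auto simp: cw_dist_eq)
qed

section \<open>Partial noncrossing matchings\<close>

definition arc_matched :: "nat \<Rightarrow> nat set set \<Rightarrow> nat \<Rightarrow> nat \<Rightarrow> bool" where
  "arc_matched n M x y \<longleftrightarrow> {x<..<y} \<subseteq> \<Union>M \<or> {1..<x} \<union> {y<..2 * n} \<subseteq> \<Union>M"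

definition partial_matching :: "nat \<Rightarrow> nat set set \<Rightarrow> bool" where
  "partial_matching n M \<longleftrightarrow> \<Union>M \<subseteq> {1..2 * n} \<and> disjoint M \<and> (\<forall>e\<in>M. card e = 2) \<and>
     (\<forall>x y. x < y \<longrightarrow> {x, y} \<in> M \<longrightarrow> arc_matched n M x y) \<and>
     \<not> (\<exists>i j k l. i < j \<and> j < k \<and> k < l \<and> {i, k} \<in> M \<and> {j, l} \<in> M)"

text \<open>An old edge crossing the new one would have one of the unmatched vertices
  \<open>x\<close> and \<open>y\<close> on each of its arcs, but one of these arcs is fully
  matched.\<close>

lemma partial_matching_insert:
  assumes M: "partial_matching n M" and xy: "x < y" "x \<in> {1..2 * n} - \<Union>M" "y \<in> {1..2 * n} - \<Union>M"
    and arc: "arc_matched n M x y"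
  shows "partial_matching n (insert {x, y} M)"
proof -
  have sub: "\<Union>M \<subseteq> {1..2 * n}" and disj: "disjoint M" and two: "\<forall>e\<in>M. card e = 2"
    and arcs: "\<And>x y. x < y \<Longrightarrow> {x, y} \<in> M \<Longrightarrow> arc_matched n M x y"
    and nc: "\<And>i j k l. i < j \<Longrightarrow> j < k \<Longrightarrow> k < l \<Longrightarrow> {i, k} \<in> M \<Longrightarrow> {j, l} \<notin> M"
    using M unfolding partial_matching_def by blast+
  have mono: "arc_matched n (insert {x, y} M) a b" if "arc_matched n M a b" for a b
    using that unfolding arc_matched_def by auto
  have "disjoint (insert {x, y} M)"
    using disj xy by (auto simp: disjoint_def)
  moreover have "False"
    if "i < j" "j < k" "k < l" and ik: "{i, k} \<in> insert {x, y} M" and jl: "{j, l} \<in> insert {x, y} M"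
    for i j k l
  proof (cases "{i, k} = {x, y}")
    case True
    then have eq: "i = x" "k = y" using that(1,2) xy(1) by (auto simp: doubleton_eq_iff)
    then have "{j, l} \<in> M" using jl that(1-3) by (auto simp: doubleton_eq_iff)
    then have "arc_matched n M j l" using arcs[of j l] that(2,3) by simp
    moreover have "k \<in> {j<..<l}" "i \<in> {1..<j}" using that xy eq by auto
    ultimately show False using xy eq unfolding arc_matched_def by blast
  next
    case False
    then have ik: "{i, k} \<in> M" using ik by simp
    then have "{j, l} = {x, y}" using nc that by blast
    then have eq: "j = x" "l = y" using that(2,3) xy(1) by (auto simp: doubleton_eq_iff)
    have "arc_matched n M i k" using arcs[of i k] ik that(1,2) by simp
    moreover have "j \<in> {i<..<k}" "l \<in> {k<..2 * n}" using that xy eq by auto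
    ultimately show False using xy eq unfolding arc_matched_def by blast
  qed
  moreover have "arc_matched n (insert {x, y} M) a b"
    if "a < b" "{a, b} \<in> insert {x, y} M" for a b
  proof (cases "{a, b} = {x, y}")
    case True
    then have "a = x" "b = y" using that(1) xy(1) by (auto simp: doubleton_eq_iff)
    then show ?thesis using mono arc by simp
  qed (use that arcs mono in auto)
  moreover have "\<Union>(insert {x, y} M) \<subseteq> {1..2 * n}" "\<forall>e\<in>insert {x, y} M. card e = 2"
    using sub two xy by auto
  ultimately show ?thesis
    unfolding partial_matching_def by blast
qed

text \<open>By counting, \<open>n\<close> disjoint pairs fill all \<open>2 * n\<close>
  vertices.\<close>

lemma partial_matching_complete:
  assumes "partial_matching n M" "card M = n"
  shows "M \<in> noncrossing_matchings n"
proof -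
  have sub: "\<Union>M \<subseteq> {1..2 * n}" and disj: "disjoint M" and two: "\<forall>e\<in>M. card e = 2"
    using assms(1) unfolding partial_matching_def by blast+
  have "card (\<Union>M) = (\<Sum>e\<in>M. card e)"
    using disj two by (intro card_Union_disjoint) (auto simp: disjnt_def disjoint_def pairwise_def
      intro: card_ge_0_finite)
  also have "\<dots> = card {1..2 * n}" using two assms(2) by simp
  finally have "\<Union>M = {1..2 * n}" using sub by (intro card_subset_eq) auto
  moreover have "{} \<notin> M" using two by force
  ultimately show ?thesis
    using assms(1) disj unfolding noncrossing_matchings_def partial_matching_def partition_on_def
    by blast
qed

lemma bar_range: "k \<in> {1..n} \<Longrightarrow> bar n k \<in> {n<..2 * n}"
  unfolding bar_def by auto

lemma bar_less_iff: "k \<in> {1..n} \<Longrightarrow> l \<in> {1..n} \<Longrightarrow> bar n k < bar n l \<longleftrightarrow> l < k"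
  unfolding bar_def by auto

lemma bar_eq_iff: "k \<in> {1..n} \<Longrightarrow> l \<in> {1..n} \<Longrightarrow> bar n k = bar n l \<longleftrightarrow> k = l"
  unfolding bar_def by auto

lemma barE:
  assumes "v \<in> {n<..2 * n}"
  obtains k where "k \<in> {1..n}" "v = bar n k"
proof
  show "2 * n + 1 - v \<in> {1..n}" "v = bar n (2 * n + 1 - v)"
    using assms unfolding bar_def by auto
qed

section \<open>The invariant of the Armstrong--Stump--Thomas construction\<close>

context perm321
begin

lemma valueE:
  assumes "v \<in> {1..n}"
  obtains e where "e \<in> {1..n}" "v = p e"
  using assms permutes_image[OF permutes] by blast

lemma Exc_iff:
  assumes "1 \<le> i"
  shows "{i..j - 1} \<in> Exc p \<longleftrightarrow> i \<in> E \<and> j = p i"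
proof
  assume "{i..j - 1} \<in> Exc p"
  then obtain k where k: "{i..j - 1} = {k..p k - 1}" "k < p k" unfolding Exc_def by blast
  then have "k \<le> p k - 1" by simp
  with k(1) have "i = k" "j - 1 = p k - 1" by (auto simp: Icc_eq_Icc)
  \<comment> \<open>Since \<open>1 \<le> i\<close> and the interval is nonempty,
    \<open>j - 1\<close> is positive, so truncated subtraction loses nothing.\<close>
  then show "i \<in> E \<and> j = p i" using k(2) assms unfolding E_def by auto
qed (auto simp: Exc_def E_def)

text \<open>The vertex that the rule of step \<open>s\<close> fixes before any search.\<close>

definition primary :: "nat \<Rightarrow> nat" where
  "primary s = (if s \<in> E then p s else bar n s)"

lemma AST_step_eq:
  assumes "s \<in> {1..n}"
  shows "AST_step n (Exc p) s M =
    insert {primary s, if s \<in> E then nearest_ccw n M (primary s) else nearest_cw n M (primary s)} M"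
proof -
  have iff: "{s..j - 1} \<in> Exc p \<longleftrightarrow> s \<in> E \<and> j = p s" for j
    using Exc_iff[of s j] assms by auto
  show ?thesis unfolding AST_step_def iff primary_def by (simp add: Let_def)
qed

lemma primary_range: "s \<in> {1..n} \<Longrightarrow> primary s \<in> {1..2 * n}"
  using bar_range[of s n] p_in_iff[of s] unfolding primary_def by auto

text \<open>The partners of the primary vertices of the first \<open>i\<close> steps are the values in \<open>V\<close> and the
  bars of the positions in \<open>B\<close>.\<close>

definition state :: "nat \<Rightarrow> nat set set \<Rightarrow> nat set \<Rightarrow> nat set \<Rightarrow> bool" where
  "state i M V B \<longleftrightarrow> partial_matching n M \<and> card M = i \<and>
     (\<forall>x y. x < y \<longrightarrow> {x, y} \<in> M \<longrightarrow>
        RSK_hat n p ! (x - 1) = Up \<and> RSK_hat n p ! (y - 1) = Down) \<and>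
     \<Union>M = primary ` {1..i} \<union> V \<union> bar n ` B \<and>
     V \<subseteq> p ` ({1..n} - E) \<and> (\<forall>v\<in>V. \<exists>k\<in>{1..i}. v \<le> p k) \<and> B \<subseteq> E \<inter> {1..i} \<and>
     card V = card {x \<in> {1..i}. g x \<notin> E} \<and> card B = card {x \<in> {1..i}. g x \<in> E}"

lemma RSK_hat_value:
  assumes "e \<in> {1..n}"
  shows "RSK_hat n p ! (p e - 1) = (if e \<in> E \<and> g e \<notin> E then Down else Up)"
proof -
  have "1 \<le> n" using assms by simp
  moreover have "p e \<in> {1..n}" using assms p_in_iff by blast
  ultimately show ?thesis
    using RSK_hat_nth(2)[OF inj] top_row_iff[OF assms] by auto
qed

lemma RSK_hat_bar:
  assumes "k \<in> {1..n}"
  shows "RSK_hat n p ! (bar n k - 1) = (if k \<notin> E \<and> g k \<in> E then Up else Down)"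
proof -
  have "1 \<le> n" using assms by simp
  then show ?thesis
    using RSK_hat_nth(3)[OF inj _ assms] bumps_iff[OF assms] by auto
qed

context
  fixes i M V B
  assumes st: "state i M V B" and i: "Suc i \<le> n"
begin

lemma pm: "partial_matching n M"
  and V: "V \<subseteq> p ` ({1..n} - E)"
  and B: "B \<subseteq> E \<inter> {1..i}"
  and cV: "card V = card {x \<in> {1..i}. g x \<notin> E}"
  and cB: "card B = card {x \<in> {1..i}. g x \<in> E}"
  and cM: "card M = i"
  and V_le: "v \<in> V \<Longrightarrow> \<exists>k\<in>{1..i}. v \<le> p k"
  and oriented: "x < y \<Longrightarrow> {x, y} \<in> M \<Longrightarrow> RSK_hat n p ! (x - 1) = Up \<and> RSK_hat n p ! (y - 1) = Down"
  and UM: "\<Union>M = primary ` {1..i} \<union> V \<union> bar n ` B"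
  using st unfolding state_def by blast+

lemma fin: "finite V" "finite B" "finite M"
proof -
  show "finite V" "finite B" using V B by (auto intro: finite_subset)
  have "finite (\<Union>M)" using pm unfolding partial_matching_def by (blast intro: finite_subset)
  then show "finite M" by (rule finite_UnionD)
qed

lemma B_range: "l \<in> B \<Longrightarrow> l \<in> {1..n}"
  using B i by auto

text \<open>Values are at most \<open>n\<close> and bars exceed \<open>n\<close>, so they never
  collide. Excedance values get matched as primary vertices, all other values as partners; for the
  bars the roles are exchanged.\<close>

lemma value_matched_iff:
  assumes "e \<in> {1..n}"
  shows "p e \<in> \<Union>M \<longleftrightarrow> (if e \<in> E then e \<le> i else p e \<in> V)"
proof -
  have "p e \<le> n" using p_in_iff assms by auto
  then have nb: "p e \<noteq> bar n k" if "k \<in> {1..n}" for k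
    using bar_range[OF that] by auto
  have "p e \<in> primary ` {1..i} \<longleftrightarrow> e \<in> E \<and> e \<le> i"
    using nb i assms unfolding primary_def by (auto simp: image_iff)
  moreover have "p e \<notin> bar n ` B" using nb B_range by blast
  moreover have "p e \<notin> V" if "e \<in> E" using V that by auto
  ultimately show ?thesis unfolding UM by auto
qed

lemma bar_matched_iff:
  assumes "k \<in> {1..n}"
  shows "bar n k \<in> \<Union>M \<longleftrightarrow> (if k \<in> E then k \<in> B else k \<le> i)"
proof -
  have nb: "bar n k \<noteq> p e" if "e \<in> {1..n}" for e
    using bar_range[OF assms] p_in_iff[of e] that by auto
  have eq: "bar n k = bar n l \<longleftrightarrow> k = l" if "l \<in> {1..n}" for l
    using bar_eq_iff[OF assms that] .
  have "bar n k \<in> primary ` {1..i} \<longleftrightarrow> k \<notin> E \<and> k \<le> i"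
    using nb eq i assms unfolding primary_def by (auto simp: image_iff)
  moreover have "bar n k \<notin> V" using nb V by blast
  moreover have "bar n k \<in> bar n ` B \<longleftrightarrow> k \<in> B" using eq B_range by blast
  ultimately show ?thesis unfolding UM using B by auto
qed

lemma primary_unmatched: "primary (Suc i) \<in> {1..2 * n} - \<Union>M"
  using primary_range[of "Suc i"] value_matched_iff[of "Suc i"] bar_matched_iff[of "Suc i"] i
  unfolding primary_def by auto

text \<open>The part common to all four kinds of steps. The primary vertex may be either end of the
  new edge, so \<open>x\<close> and \<open>z\<close> name its two ends in increasing order.\<close>

lemma state_add:
  assumes y: "y \<in> {1..2 * n} - \<Union>M" "x = primary (Suc i) \<and> z = y \<or> z = primary (Suc i) \<and> x = y" "x < z"
    and arc: "arc_matched n M x z"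
    and ori: "RSK_hat n p ! (x - 1) = Up" "RSK_hat n p ! (z - 1) = Down"
    and V': "V' \<subseteq> p ` ({1..n} - E)" "\<forall>v\<in>V'. \<exists>k\<in>{1..Suc i}. v \<le> p k"
      "card V' = card {x \<in> {1..Suc i}. g x \<notin> E}"
    and B': "B' \<subseteq> E \<inter> {1..Suc i}" "card B' = card {x \<in> {1..Suc i}. g x \<in> E}"
    and new: "V' \<union> bar n ` B' = insert y (V \<union> bar n ` B)"
  shows "state (Suc i) (insert {primary (Suc i), y} M) V' B'"
proof -
  have eq: "{primary (Suc i), y} = {x, z}" using y(2) by auto
  have "x \<in> {1..2 * n} - \<Union>M" "z \<in> {1..2 * n} - \<Union>M"
    using y primary_unmatched by auto
  then have "partial_matching n (insert {x, z} M)"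
    using partial_matching_insert[OF pm] y arc by blast
  moreover have "{x, z} \<notin> M" using \<open>x \<in> _\<close> by auto
  then have "card (insert {x, z} M) = Suc i" using fin cM by simp
  moreover have "RSK_hat n p ! (a - 1) = Up \<and> RSK_hat n p ! (b - 1) = Down"
    if "a < b" "{a, b} \<in> insert {x, z} M" for a b
    using that oriented[of a b] ori y(3) by (auto simp: doubleton_eq_iff)
  moreover have "primary ` {1..Suc i} = insert (primary (Suc i)) (primary ` {1..i})"
    by (simp add: atLeastAtMostSuc_conv)
  then have "\<Union>(insert {x, z} M) = primary ` {1..Suc i} \<union> V' \<union> bar n ` B'"
    using UM new unfolding eq[symmetric] by auto
  ultimately show ?thesis
    unfolding state_def eq using V' B' by blast
qed

lemma card_steps_Suc:
  "card {x \<in> {1..Suc i}. P x} = card {x \<in> {1..i}. P x} + (if P (Suc i) then 1 else 0)"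
proof -
  have "{x \<in> {1..Suc i}. P x} = {x \<in> {1..i}. P x} \<union> (if P (Suc i) then {Suc i} else {})"
    by (auto simp: le_Suc_eq)
  then show ?thesis by auto
qed

text \<open>The primary vertex is the value of a bumped excedance or the bar of a position that
  bumps nothing, hence a \<open>Down\<close>. The partner is a value off \<open>E\<close>, which is
  never bumped, hence an \<open>Up\<close>.\<close>

lemma state_add_value:
  assumes g: "g (Suc i) \<notin> E" and v: "v \<in> p ` ({1..n} - E) - V" "v \<le> p (Suc i)"
    and arc: "arc_matched n M v (primary (Suc i))"
  shows "state (Suc i) (insert {primary (Suc i), v} M) (insert v V) B"
proof (rule state_add[where x = v and z = "primary (Suc i)"])
  obtain e where e: "e \<in> {1..n}" "e \<notin> E" "v = p e" using v(1) by blast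
  have v_le: "v \<in> {1..n}" using e p_in_iff by blast
  show "v \<in> {1..2 * n} - \<Union>M" using value_matched_iff[OF e(1)] e v v_le by auto
  have ne: "v \<noteq> p (Suc i)" if "Suc i \<in> E" using e that by auto
  show "v < primary (Suc i)"
    unfolding primary_def using v(2) ne bar_range[of "Suc i" n] i v_le by auto
  show "RSK_hat n p ! (v - 1) = Up" using RSK_hat_value[OF e(1)] e by simp
  show "RSK_hat n p ! (primary (Suc i) - 1) = Down"
    unfolding primary_def using RSK_hat_value[of "Suc i"] RSK_hat_bar[of "Suc i"] i g by auto
  show "insert v V \<subseteq> p ` ({1..n} - E)" using V v by auto
  show "\<forall>v\<in>insert v V. \<exists>k\<in>{1..Suc i}. v \<le> p k"
    using V_le v(2) by (auto simp: atLeastAtMostSuc_conv)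
  show "card (insert v V) = card {x \<in> {1..Suc i}. g x \<notin> E}"
    unfolding card_steps_Suc using cV g v fin by simp
  show "card B = card {x \<in> {1..Suc i}. g x \<in> E}"
    unfolding card_steps_Suc using cB g by simp
qed (use arc B in auto)

text \<open>The primary vertex is the value of an unbumped excedance or the bar of a bumper, hence
  an \<open>Up\<close>. The partner is the bar of an excedance, which never bumps, hence a
  \<open>Down\<close>.\<close>

lemma state_add_bar:
  assumes g: "g (Suc i) \<in> E" and k: "k \<in> E \<inter> {1..Suc i} - B"
    and arc: "arc_matched n M (primary (Suc i)) (bar n k)"
  shows "state (Suc i) (insert {primary (Suc i), bar n k} M) V (insert k B)"
proof (rule state_add[where x = "primary (Suc i)" and z = "bar n k"])
  have k': "k \<in> {1..n}" using k i by auto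
  show "bar n k \<in> {1..2 * n} - \<Union>M" using bar_matched_iff[OF k'] bar_range[OF k'] k by auto
  have "k < Suc i" if "Suc i \<notin> E" using k that by (cases "k = Suc i") auto
  moreover have "p (Suc i) \<le> n" using p_in_iff[of "Suc i"] i by auto
  ultimately show "primary (Suc i) < bar n k"
    unfolding primary_def using bar_range[OF k'] bar_less_iff[OF _ k', of "Suc i"] i by auto
  show "RSK_hat n p ! (bar n k - 1) = Down" using RSK_hat_bar[OF k'] k by simp
  show "RSK_hat n p ! (primary (Suc i) - 1) = Up"
    unfolding primary_def using RSK_hat_value[of "Suc i"] RSK_hat_bar[of "Suc i"] i g by auto
  show "\<forall>v\<in>V. \<exists>k\<in>{1..Suc i}. v \<le> p k"
    using V_le by (auto simp: atLeastAtMostSuc_conv)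
  show "card V = card {x \<in> {1..Suc i}. g x \<notin> E}"
    unfolding card_steps_Suc using cV g by simp
  show "card (insert k B) = card {x \<in> {1..Suc i}. g x \<in> E}"
    unfolding card_steps_Suc using cB g k fin by simp
qed (use arc B V k in auto)

lemma inj_on_g_subset: "S \<subseteq> {1..n} \<Longrightarrow> inj_on g S"
  by (rule inj_on_subset[OF inj_on_g])

text \<open>Pigeonhole: by \<open>value_steps_bound\<close>, \<open>p \<circ> g\<close> injects the
  steps of this type, the current one included, into the candidates, while \<open>V\<close> has one
  element fewer.\<close>

lemma exists_unmatched_value:
  assumes "g (Suc i) \<notin> E"
  shows "{v \<in> p ` ({1..n} - E). v \<le> p (Suc i)} - V \<noteq> {}"
proof
  let ?W = "{v \<in> p ` ({1..n} - E). v \<le> p (Suc i)}" and ?X = "{x \<in> {1..Suc i}. g x \<notin> E}"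
  assume "?W - V = {}"
  then have "card ?W \<le> card V" using fin by (intro card_mono) auto
  moreover have "card ?X \<le> card ?W"
  proof (rule card_inj_on_le)
    have "inj_on g ?X" using i by (intro inj_on_g_subset) auto
    then show "inj_on (p \<circ> g) ?X" by (auto simp: inj_on_def)
    show "(p \<circ> g) ` ?X \<subseteq> ?W"
      using value_steps_bound[of "Suc i"] g_range i assms by auto
  qed auto
  ultimately show False using cV assms unfolding card_steps_Suc by simp
qed

text \<open>The same count with \<open>g\<close> itself, which by \<open>bar_steps_bound\<close>
  does not lead beyond the current step.\<close>

lemma exists_unmatched_bar:
  assumes "g (Suc i) \<in> E"
  shows "E \<inter> {1..Suc i} - B \<noteq> {}"
proof
  let ?W = "E \<inter> {1..Suc i}" and ?X = "{x \<in> {1..Suc i}. g x \<in> E}"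
  assume "?W - B = {}"
  then have "card ?W \<le> card B" using fin by (intro card_mono) auto
  moreover have "card ?X \<le> card ?W"
  proof (rule card_inj_on_le)
    show "inj_on g ?X" using i by (intro inj_on_g_subset) auto
    show "g ` ?X \<subseteq> ?W"
    proof
      fix y assume "y \<in> g ` ?X"
      then obtain x where x: "x \<in> {1..Suc i}" "g x \<in> E" "y = g x" by blast
      then have "g x \<le> x" using bar_steps_bound i by auto
      then show "y \<in> ?W" using x E_range(1)[OF x(2)] by auto
    qed
  qed auto
  ultimately show False using cB assms unfolding card_steps_Suc by simp
qed

section \<open>The four kinds of steps\<close>

lemma state_step_bumped:
  assumes s: "Suc i \<in> E" "g (Suc i) \<notin> E"
  shows "\<exists>V' B'. state (Suc i) (AST_step n (Exc p) (Suc i) M) V' B'"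
proof -
  define W where "W = {v \<in> p ` ({1..n} - E). v \<le> p (Suc i)} - V"
  \<comment> \<open>The counterclockwise search runs downwards from \<open>p (Suc i)\<close>, so it
    meets the largest free candidate first.\<close>
  define v where "v = Max W"
  have "finite W" "W \<noteq> {}" using exists_unmatched_value[OF s(2)] unfolding W_def by auto
  then have v: "v \<in> W" and max: "\<And>u. u \<in> W \<Longrightarrow> u \<le> v" unfolding v_def by auto
  then obtain e where e: "e \<in> {1..n}" "e \<notin> E" "v = p e" "v \<le> p (Suc i)" "v \<notin> V"
    unfolding W_def by auto
  have prim: "primary (Suc i) = p (Suc i)" using s by (simp add: primary_def)
  have "v \<noteq> p (Suc i)" using e s by auto
  then have less: "v < p (Suc i)" using e(4) by simp
  have ps: "p (Suc i) \<in> {1..n}" using p_in_iff i by auto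
  \<comment> \<open>A smaller excedance value belongs to an earlier excedance and is matched; a
    value off \<open>E\<close> in this gap lies in \<open>V\<close> because \<open>v\<close> is
    maximal.\<close>
  have arc: "{v<..<p (Suc i)} \<subseteq> \<Union>M"
  proof
    fix u assume u: "u \<in> {v<..<p (Suc i)}"
    then have "u \<in> {1..n}" using ps by auto
    then obtain d where d: "d \<in> {1..n}" "u = p d" by (rule valueE)
    show "u \<in> \<Union>M"
    proof (cases "d \<in> E")
      case True
      then have "\<not> Suc i < d" using exc_left_max[of d "Suc i"] u d by auto
      moreover have "d \<noteq> Suc i" using u d by auto
      ultimately show ?thesis using value_matched_iff[OF d(1)] d True by simp
    next
      case False
      moreover have "u \<notin> W" using max[of u] u by auto
      ultimately have "u \<in> V" using u d unfolding W_def by auto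
      then show ?thesis using value_matched_iff[OF d(1)] d False by simp
    qed
  qed
  have "v \<in> {1..n}" using e p_in_iff by blast
  then have "v \<in> {1..2 * n} - \<Union>M" using value_matched_iff[OF e(1)] e by auto
  then have "nearest_ccw n M (p (Suc i)) = v"
    using nearest_ccw_eq[of "p (Suc i)" n v M] ps arc less by auto
  then have "AST_step n (Exc p) (Suc i) M = insert {primary (Suc i), v} M"
    using AST_step_eq[of "Suc i" M] i s prim by simp
  moreover have "state (Suc i) (insert {primary (Suc i), v} M) (insert v V) B"
    using state_add_value[of v] s e arc unfolding arc_matched_def prim by blast
  ultimately show ?thesis by auto
qed

lemma state_step_nonbumper:
  assumes s: "Suc i \<notin> E" "g (Suc i) \<notin> E"
  shows "\<exists>V' B'. state (Suc i) (AST_step n (Exc p) (Suc i) M) V' B'"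
proof -
  define W where "W = {v \<in> p ` ({1..n} - E). v \<le> p (Suc i)} - V"
  \<comment> \<open>The clockwise search passes the bars of all earlier positions up to
    \<open>2 * n\<close> and continues upwards from 1. Once those bars are known to be matched, it
    ends at the least free candidate.\<close>
  define v where "v = Min W"
  have "finite W" "W \<noteq> {}" using exists_unmatched_value[OF s(2)] unfolding W_def by auto
  then have v: "v \<in> W" and min: "\<And>u. u \<in> W \<Longrightarrow> v \<le> u" unfolding v_def by auto
  then obtain e where e: "e \<in> {1..n}" "e \<notin> E" "v = p e" "v \<le> p (Suc i)" "v \<notin> V"
    unfolding W_def by auto
  have prim: "primary (Suc i) = bar n (Suc i)" using s by (simp add: primary_def)
  have si: "Suc i \<in> {1..n}" using i by simp
  have v_le: "v \<in> {1..n}" using e p_in_iff by blast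
  have low: "u \<in> \<Union>M" if u: "u \<in> {1..<v}" for u
  proof -
    have "u \<in> {1..n}" using u v_le by auto
    then obtain d where d: "d \<in> {1..n}" "u = p d" by (rule valueE)
    show "u \<in> \<Union>M"
    proof (cases "d \<in> E")
      case True
      then have "\<not> Suc i < d" using nonexc_right_min[of "Suc i" d] s u d e by auto
      moreover have "d \<noteq> Suc i" using True s by auto
      ultimately show ?thesis using value_matched_iff[OF d(1)] d True by simp
    next
      case False
      moreover have "u \<notin> W" using min[of u] u by auto
      ultimately have "u \<in> V" using u d e unfolding W_def by auto
      then show ?thesis using value_matched_iff[OF d(1)] d False by simp
    qed
  qed
  \<comment> \<open>By \<open>exc_before_nonbumper\<close>, \<open>g\<close> maps the excedances up
    to \<open>i\<close> to steps up to \<open>i\<close> that consumed a bar. So there are at most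
    \<open>card B\<close> of them, and all their bars are used.\<close>
  have "card (E \<inter> {1..i}) \<le> card {x \<in> {1..i}. g x \<in> E}"
  proof (rule card_inj_on_le)
    show "inj_on g (E \<inter> {1..i})" using i by (intro inj_on_g_subset) auto
    show "g ` (E \<inter> {1..i}) \<subseteq> {x \<in> {1..i}. g x \<in> E}"
    proof
      fix x assume "x \<in> g ` (E \<inter> {1..i})"
      then obtain e where "x = g e" "e \<in> E" "e \<in> {1..i}" by blast
      then show "x \<in> {x \<in> {1..i}. g x \<in> E}"
        using exc_before_nonbumper[OF si s, of e] g_range[of e] g_g[of e] i by auto
    qed
  qed auto
  then have B_eq: "B = E \<inter> {1..i}" using B cB by (intro card_seteq) auto
  have high: "u \<in> \<Union>M" if u: "u \<in> {bar n (Suc i)<..2 * n}" for u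
  proof -
    have "u \<in> {n<..2 * n}" using u bar_range[OF si] by auto
    then obtain k where k: "k \<in> {1..n}" "u = bar n k" by (rule barE)
    then have "k < Suc i" using u bar_less_iff[OF si k(1)] by simp
    then show ?thesis using bar_matched_iff[OF k(1)] k B_eq by auto
  qed
  have "v \<in> {1..2 * n} - \<Union>M" using value_matched_iff[OF e(1)] e v_le by auto
  moreover have "v < bar n (Suc i)" using v_le bar_range[OF si] by auto
  ultimately have "nearest_cw n M (bar n (Suc i)) = v"
    using low high bar_range[OF si] by (intro nearest_cw_eq) auto
  then have "AST_step n (Exc p) (Suc i) M = insert {primary (Suc i), v} M"
    using AST_step_eq[of "Suc i" M] i s prim by simp
  moreover have "arc_matched n M v (primary (Suc i))"
    unfolding arc_matched_def prim using low high by blast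
  then have "state (Suc i) (insert {primary (Suc i), v} M) (insert v V) B"
    using state_add_value[of v] s e by blast
  ultimately show ?thesis by auto
qed

lemma state_step_bumper:
  assumes s: "Suc i \<notin> E" "g (Suc i) \<in> E"
  shows "\<exists>V' B'. state (Suc i) (AST_step n (Exc p) (Suc i) M) V' B'"
proof -
  define W where "W = E \<inter> {1..Suc i} - B"
  \<comment> \<open>Clockwise from \<open>bar n (Suc i)\<close> come the bars of earlier positions
    in decreasing order of position, so the largest free one is met first.\<close>
  define k where "k = Max W"
  have "finite W" "W \<noteq> {}" using exists_unmatched_bar[OF s(2)] unfolding W_def by auto
  then have k: "k \<in> W" and max: "\<And>l. l \<in> W \<Longrightarrow> l \<le> k" unfolding k_def by auto
  have prim: "primary (Suc i) = bar n (Suc i)" using s by (simp add: primary_def)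
  have si: "Suc i \<in> {1..n}" using i by simp
  have k': "k \<in> {1..n}" "k \<in> E" "k \<notin> B" using k i unfolding W_def by auto
  have "k \<noteq> Suc i" using s k' by auto
  then have "k < Suc i" using k unfolding W_def by auto
  then have less: "bar n (Suc i) < bar n k" using bar_less_iff[OF si k'(1)] by simp
  have arc: "{bar n (Suc i)<..<bar n k} \<subseteq> \<Union>M"
  proof
    fix u assume u: "u \<in> {bar n (Suc i)<..<bar n k}"
    then have "u \<in> {n<..2 * n}" using bar_range[OF si] bar_range[OF k'(1)] by auto
    then obtain l where l: "l \<in> {1..n}" "u = bar n l" by (rule barE)
    then have "l < Suc i" "k < l"
      using u bar_less_iff[OF si l(1)] bar_less_iff[OF l(1) k'(1)] by auto
    moreover from this have "l \<notin> W" using max[of l] by auto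
    ultimately show "u \<in> \<Union>M" using bar_matched_iff[OF l(1)] l unfolding W_def by auto
  qed
  have "bar n k \<in> {1..2 * n} - \<Union>M"
    using bar_matched_iff[OF k'(1)] bar_range[OF k'(1)] k' by auto
  then have "nearest_cw n M (bar n (Suc i)) = bar n k"
    using nearest_cw_eq[of "bar n (Suc i)" n "bar n k" M] bar_range[OF si] arc less by auto
  then have "AST_step n (Exc p) (Suc i) M = insert {primary (Suc i), bar n k} M"
    using AST_step_eq[of "Suc i" M] i s prim by simp
  moreover have "state (Suc i) (insert {primary (Suc i), bar n k} M) V (insert k B)"
    using state_add_bar[of k] s k arc unfolding W_def arc_matched_def prim by blast
  ultimately show ?thesis by auto
qed

lemma state_step_unbumped:
  assumes s: "Suc i \<in> E" "g (Suc i) \<in> E"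
  shows "\<exists>V' B'. state (Suc i) (AST_step n (Exc p) (Suc i) M) V' B'"
proof -
  define W where "W = E \<inter> {1..Suc i} - B"
  \<comment> \<open>The counterclockwise search descends from \<open>p (Suc i)\<close> to 1 and goes
    on from \<open>2 * n\<close>, the bar of 1, through increasing positions. The position
    \<open>Suc i\<close> itself is among the candidates.\<close>
  define k where "k = Min W"
  have "finite W" "W \<noteq> {}" using exists_unmatched_bar[OF s(2)] unfolding W_def by auto
  then have k: "k \<in> W" and min: "\<And>l. l \<in> W \<Longrightarrow> k \<le> l" unfolding k_def by auto
  have prim: "primary (Suc i) = p (Suc i)" using s by (simp add: primary_def)
  have si: "Suc i \<in> {1..n}" using i by simp
  have k': "k \<in> {1..n}" "k \<in> E" "k \<notin> B" "k \<le> Suc i" using k i unfolding W_def by auto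
  have ps: "p (Suc i) \<in> {1..n}" using p_in_iff i by auto
  have high: "u \<in> \<Union>M" if u: "u \<in> {bar n k<..2 * n}" for u
  proof -
    have "u \<in> {n<..2 * n}" using u bar_range[OF k'(1)] by auto
    then obtain l where l: "l \<in> {1..n}" "u = bar n l" by (rule barE)
    then have "l < k" using u bar_less_iff[OF k'(1) l(1)] by simp
    moreover from this have "l \<notin> W" using min[of l] by auto
    ultimately show ?thesis using bar_matched_iff[OF l(1)] l k'(4) unfolding W_def by auto
  qed
  let ?L = "{v \<in> p ` ({1..n} - E). v < p (Suc i)}"
  \<comment> \<open>Here the bound on \<open>V\<close> kept in \<open>state\<close> enters: a used
    value is at most some earlier \<open>p l\<close>, which is below the left-to-right maximum
    \<open>p (Suc i)\<close>.\<close>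
  have "V \<subseteq> ?L"
  proof
    fix v assume v: "v \<in> V"
    then obtain l where "l \<in> {1..i}" "v \<le> p l" using V_le by blast
    then show "v \<in> ?L" using exc_left_max[OF s(1), of l] V v by auto
  qed
  \<comment> \<open>By \<open>nonexc_below_unbumped\<close>, \<open>g\<close> sends the positions of
    these values to steps up to \<open>i\<close> that consumed a value; so all of \<open>?L\<close>
    is used up.\<close>
  moreover have "card ?L \<le> card {x \<in> {1..i}. g x \<notin> E}"
  proof (rule card_inj_on_le)
    have L: "inv p v \<in> {1..n} \<and> inv p v \<notin> E \<and> p (inv p v) = v" if "v \<in> ?L" for v
      using that inj by (auto simp: inv_f_f)
    have "inj_on g (inv p ` ?L)" using L by (intro inj_on_g_subset) blast
    moreover have "inj_on (inv p) ?L" using L by (metis (no_types, lifting) inj_onI)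
    ultimately show "inj_on (g \<circ> inv p) ?L" by (rule comp_inj_on[rotated])
    show "(g \<circ> inv p) ` ?L \<subseteq> {x \<in> {1..i}. g x \<notin> E}"
    proof
      fix x assume "x \<in> (g \<circ> inv p) ` ?L"
      then obtain v where v: "v \<in> ?L" "x = g (inv p v)" by auto
      with L[OF v(1)] show "x \<in> {x \<in> {1..i}. g x \<notin> E}"
        using nonexc_below_unbumped[OF s, of "inv p v"] g_range[of "inv p v"] g_g[of "inv p v"] by auto
    qed
  qed auto
  ultimately have V_eq: "V = ?L" using cV by (intro card_seteq) auto
  have low: "u \<in> \<Union>M" if u: "u \<in> {1..<p (Suc i)}" for u
  proof -
    have "u \<in> {1..n}" using u ps by auto
    then obtain d where d: "d \<in> {1..n}" "u = p d" by (rule valueE)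
    show "u \<in> \<Union>M"
    proof (cases "d \<in> E")
      case True
      then have "\<not> Suc i < d" using exc_left_max[of d "Suc i"] u d by auto
      moreover have "d \<noteq> Suc i" using u d by auto
      ultimately show ?thesis using value_matched_iff[OF d(1)] d True by simp
    next
      case False
      then have "u \<in> V" using u d V_eq by auto
      then show ?thesis using value_matched_iff[OF d(1)] d False by simp
    qed
  qed
  have "bar n k \<in> {1..2 * n} - \<Union>M"
    using bar_matched_iff[OF k'(1)] bar_range[OF k'(1)] k' by auto
  moreover have "p (Suc i) < bar n k" using ps bar_range[OF k'(1)] by auto
  ultimately have "nearest_ccw n M (p (Suc i)) = bar n k"
    using low high ps by (intro nearest_ccw_eq) auto
  then have "AST_step n (Exc p) (Suc i) M = insert {primary (Suc i), bar n k} M"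
    using AST_step_eq[of "Suc i" M] i s prim by simp
  moreover have "arc_matched n M (primary (Suc i)) (bar n k)"
    unfolding arc_matched_def prim using low high by blast
  then have "state (Suc i) (insert {primary (Suc i), bar n k} M) V (insert k B)"
    using state_add_bar[of k] s k unfolding W_def by blast
  ultimately show ?thesis by auto
qed

end

section \<open>All steps together\<close>

lemma state_fold: "i \<le> n \<Longrightarrow> \<exists>V B. state i (fold (AST_step n (Exc p)) [1..<Suc i] {}) V B"
proof (induction i)
  case 0
  have "state 0 {} {} {}" unfolding state_def partial_matching_def by simp
  then show ?case by auto
next
  case (Suc i)
  then obtain V B where "state i (fold (AST_step n (Exc p)) [1..<Suc i] {}) V B" by auto
  from this Suc.prems show ?case
    using state_step_bumped state_step_nonbumper state_step_bumper state_step_unbumped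
    by (cases "Suc i \<in> E"; cases "g (Suc i) \<in> E") simp_all
qed

lemma AST_Exc:
  assumes "1 \<le> n"
  shows "AST n (Exc p) \<in> noncrossing_matchings n" "AST n (Exc p) = Match (RSK_hat n p)"
proof -
  obtain V B where st: "state n (AST n (Exc p)) V B"
    using state_fold[of n] unfolding AST_def by auto
  then show nc: "AST n (Exc p) \<in> noncrossing_matchings n"
    unfolding state_def by (blast intro: partial_matching_complete)
  show "AST n (Exc p) = Match (RSK_hat n p)"
    using nc RSK_hat_nth(1)[OF inj assms]
  proof (rule noncrossing_matching_eq_Match)
    show "RSK_hat n p ! (x - 1) = Up \<and> RSK_hat n p ! (y - 1) = Down"
      if "x < y" "{x, y} \<in> AST n (Exc p)" for x y
      using st that unfolding state_def by blast
  qed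
qed

end

section \<open>Surjectivity of \<open>Exc\<close>\<close>

text \<open>The inverse of the increasing enumeration of \<open>A\<close>, followed by that of
  \<open>B\<close>.\<close>

lemma strict_mono_bij_between:
  fixes A B :: "nat set"
  assumes "finite A" "finite B" "card A = card B"
  obtains h where "bij_betw h A B" "strict_mono_on A h"
proof -
  obtain a where a: "bij_betw a {..<card A} A" "strict_mono_on {..<card A} a"
    using ex_bij_betw_strict_mono_card[OF assms(1)] by blast
  obtain b where b: "bij_betw b {..<card A} B" "strict_mono_on {..<card A} b"
    using ex_bij_betw_strict_mono_card[OF assms(2)] assms(3) by metis
  define c where "c = inv_into {..<card A} a"
  have c: "bij_betw c A {..<card A}"
    unfolding c_def using a(1) by (rule bij_betw_inv_into)
  have "strict_mono_on A (b \<circ> c)"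
  proof (rule strict_mono_onI)
    fix x y assume xy: "x \<in> A" "y \<in> A" "x < y"
    have "c x \<in> {..<card A}" "c y \<in> {..<card A}" using bij_betwE[OF c] xy by blast+
    moreover have "a (c x) = x" "a (c y) = y"
      unfolding c_def using a(1) xy by (simp_all add: bij_betw_inv_into_right)
    ultimately have "c x < c y"
      using strict_mono_on_less[OF a(2)] xy(3) by metis
    then show "(b \<circ> c) x < (b \<circ> c) y"
      using strict_mono_onD[OF b(2)] \<open>c x \<in> _\<close> \<open>c y \<in> _\<close> by simp
  qed
  then show ?thesis using that bij_betw_trans[OF c b(1)] by blast
qed

text \<open>Two intervals with a common start are nested, and so are two of which the later start
  has no later end. Hence the ends are a strictly increasing function of the starts.\<close>

lemma antichain_starts:
  assumes A: "A \<in> antichains (n - 1)"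
  obtains S f where "S \<subseteq> {1..n}" "f ` S \<subseteq> {1..n}" "strict_mono_on S f" "\<And>i. i \<in> S \<Longrightarrow> i < f i"
    "A = {{i..f i - 1} | i. i \<in> S}"
proof -
  have ints: "\<exists>i j. I = {i..j} \<and> 1 \<le> i \<and> i \<le> j \<and> j \<le> n - 1" if "I \<in> A" for I
    using A that unfolding antichains_def intervals_def by blast
  have anti: "I = J" if "I \<in> A" "J \<in> A" "I \<subseteq> J" for I J
    using A that unfolding antichains_def by blast
  define S where "S = {i. \<exists>j\<ge>i. {i..j} \<in> A}"
  \<comment> \<open>One more than the end of the interval, which is the value that
    \<open>Exc\<close> expects at \<open>i\<close>.\<close>
  define f where "f i = Suc (SOME j. i \<le> j \<and> {i..j} \<in> A)" for i
  have f: "i < f i" "{i..f i - 1} \<in> A" if "i \<in> S" for i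
  proof -
    have "\<exists>j. i \<le> j \<and> {i..j} \<in> A" using that unfolding S_def by blast
    from someI_ex[OF this] show "i < f i" "{i..f i - 1} \<in> A" unfolding f_def by auto
  qed
  have range: "1 \<le> i \<and> f i \<le> n" if i: "i \<in> S" for i
  proof -
    obtain k j where "{i..f i - 1} = {k..j}" "1 \<le> k" "k \<le> j" "j \<le> n - 1"
      using ints[OF f(2)[OF i]] by blast
    then show ?thesis using f(1)[OF i] by (auto simp: Icc_eq_Icc)
  qed
  show ?thesis
  proof (rule that[of S f])
    show "f ` S \<subseteq> {1..n}"
    proof (rule image_subsetI)
      show "f i \<in> {1..n}" if "i \<in> S" for i using range[OF that] f(1)[OF that] by simp
    qed
    show "S \<subseteq> {1..n}"
    proof
      show "i \<in> {1..n}" if "i \<in> S" for i using range[OF that] f(1)[OF that] by simp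
    qed
    show "strict_mono_on S f"
    proof (rule strict_mono_onI)
      fix i i' assume i: "i \<in> S" "i' \<in> S" "i < i'"
      show "f i < f i'"
      proof (rule ccontr)
        assume "\<not> f i < f i'"
        then have "{i'..f i' - 1} \<subseteq> {i..f i - 1}" using i(3) by auto
        then have "{i'..f i' - 1} = {i..f i - 1}" using anti f(2) i by blast
        then show False using f(1)[OF i(2)] i(3) by (auto simp: Icc_eq_Icc)
      qed
    qed
    show "i < f i" if "i \<in> S" for i using f(1)[OF that] .
    show "A = {{i..f i - 1} | i. i \<in> S}"
    proof (intro equalityI subsetI)
      fix I assume I: "I \<in> A"
      then obtain i j where ij: "I = {i..j}" "i \<le> j" using ints by blast
      then have i: "i \<in> S" using I unfolding S_def by blast
      have "{i..j} \<subseteq> {i..f i - 1} \<or> {i..f i - 1} \<subseteq> {i..j}"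
        by (cases "j \<le> f i - 1") auto
      then have "I = {i..f i - 1}"
        using anti[OF I f(2)[OF i]] anti[OF f(2)[OF i] I] unfolding ij by metis
      then show "I \<in> {{i..f i - 1} | i. i \<in> S}" using i by blast
    next
      fix I assume "I \<in> {{i..f i - 1} | i. i \<in> S}"
      then obtain i where "i \<in> S" "I = {i..f i - 1}" by blast
      then show "I \<in> A" using f(2)[of i] by simp
    qed
  qed
qed

text \<open>Guarantees that \<open>inv_into\<close> yields a genuine preimage. The values
  \<open>f\<close> go to the starts in \<open>S\<close>, and the remaining values fill the remaining
  positions in increasing order.\<close>

lemma Exc_surj:
  assumes "A \<in> antichains (n - 1)"
  shows "\<exists>\<pi>\<in>Av321 n. Exc \<pi> = A"
proof -
  obtain S f where S: "S \<subseteq> {1..n}" "f ` S \<subseteq> {1..n}" and f: "strict_mono_on S f"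
      "\<And>i. i \<in> S \<Longrightarrow> i < f i" and A: "A = {{i..f i - 1} | i. i \<in> S}"
    by (rule antichain_starts[OF assms]) blast
  have inj_f: "inj_on f S" using f(1) by (rule strict_mono_on_imp_inj_on)
  define N where "N = {1..n} - S"
  define N' where "N' = {1..n} - f ` S"
  have finS: "finite S" using S(1) by (rule finite_subset) simp
  have "card N = card N'"
    unfolding N_def N'_def using S finS card_image[OF inj_f] by (simp add: card_Diff_subset)
  then obtain h where h: "bij_betw h N N'" "strict_mono_on N h"
    using strict_mono_bij_between[of N N'] unfolding N_def N'_def by auto
  have h_le: "h k \<le> k" if k: "k \<in> N" for k
  proof (rule ccontr)
    assume less: "\<not> h k \<le> k"
    have k1: "k \<le> n" using k unfolding N_def by simp
    have "N' \<inter> {1..k} \<subseteq> h ` (N \<inter> {1..<k})"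
    proof
      fix v assume v: "v \<in> N' \<inter> {1..k}"
      then obtain x where x: "x \<in> N" "v = h x" using h(1) by (auto simp: bij_betw_def)
      then have "x < k" using v less strict_mono_on_less[OF h(2) x(1) k] by auto
      then show "v \<in> h ` (N \<inter> {1..<k})" using x unfolding N_def by auto
    qed
    then have "card (N' \<inter> {1..k}) \<le> card (N \<inter> {1..<k})"
      using surj_card_le[of "N \<inter> {1..<k}" "N' \<inter> {1..k}" h] by auto
    also have "\<dots> < card (N \<inter> {1..k})"
      using k unfolding N_def by (intro psubset_card_mono) auto
    finally have "card (N' \<inter> {1..k}) < card (N \<inter> {1..k})" .
    moreover have "card (f ` S \<inter> {1..k}) \<le> card (S \<inter> {1..k})"
    proof (rule surj_card_le)
      show "f ` S \<inter> {1..k} \<subseteq> f ` (S \<inter> {1..k})" 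
      proof
        fix v assume "v \<in> f ` S \<inter> {1..k}"
        then obtain i where i: "i \<in> S" "v = f i" "f i \<le> k" by auto
        then have "i \<in> {1..k}" using f(2)[OF i(1)] S(1) by auto
        then show "v \<in> f ` (S \<inter> {1..k})" using i by blast
      qed
    qed (use finS in auto)
    moreover have "card (({1..n} - X) \<inter> {1..k}) = k - card (X \<inter> {1..k})" for X
    proof -
      have "({1..n} - X) \<inter> {1..k} = {1..k} - X \<inter> {1..k}" using k1 by auto
      then show ?thesis by (simp add: card_Diff_subset)
    qed
    ultimately show False unfolding N_def N'_def by simp
  qed
  define p where "p i = (if i \<in> S then f i else if i \<in> N then h i else i)" for i
  have "bij_betw f S (f ` S)" using inj_f by (simp add: bij_betw_def)
  then have "bij_betw p S (f ` S)" by (rule bij_betw_cong[THEN iffD1, rotated]) (simp add: p_def)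
  moreover have "bij_betw p N N'"
    using h(1) by (rule bij_betw_cong[THEN iffD1, rotated]) (simp add: p_def N_def)
  moreover have "f ` S \<inter> N' = {}" unfolding N'_def by blast
  ultimately have "bij_betw p (S \<union> N) (f ` S \<union> N')" by (rule bij_betw_combine)
  moreover have "S \<union> N = {1..n}" "f ` S \<union> N' = {1..n}" using S unfolding N_def N'_def by auto
  ultimately have "bij_betw p {1..n} {1..n}" by simp
  then have perm: "p permutes {1..n}"
  proof (rule bij_imp_permutes)
    show "p x = x" if "x \<notin> {1..n}" for x
      using that S(1) unfolding p_def N_def by auto
  qed
  have mono_S: "p i < p j" if "i < j" "i \<in> S" "j \<in> S" for i j
    using strict_mono_onD[OF f(1)] that unfolding p_def by simp
  have mono_N: "p i < p j" if "i < j" "i \<in> N" "j \<in> N" for i j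
    using strict_mono_onD[OF h(2)] that unfolding p_def N_def by simp
  have "p \<in> Av321 n"
    unfolding Av321_def
  proof (intro CollectI conjI notI perm)
    assume "\<exists>i j k. 1 \<le> i \<and> i < j \<and> j < k \<and> k \<le> n \<and> p i > p j \<and> p j > p k"
    then obtain i j k where ijk: "1 \<le> i" "i < j" "j < k" "k \<le> n" "p i > p j" "p j > p k" by blast
    \<comment> \<open>Two of the three positions lie in the same one of \<open>S\<close> and
      \<open>N\<close>, and \<open>p\<close> increases on each.\<close>
    then have "{i, j, k} \<subseteq> S \<union> N" unfolding N_def by auto
    then show False
      using mono_S[of i j] mono_S[of j k] mono_S[of i k] mono_N[of i j] mono_N[of j k] mono_N[of i k]
        ijk by auto
  qed
  moreover have "i < p i \<longleftrightarrow> i \<in> S" for i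
    using f(2) h_le unfolding p_def by (auto simp: not_less)
  then have "Exc p = A"
    unfolding Exc_def A by (metis (full_types) p_def)
  ultimately show ?thesis by blast
qed

theorem theorem5p2:
  fixes n :: nat
  assumes "n \<ge> 1"
  shows "AST n \<in> antichains (n - 1) \<rightarrow> noncrossing_matchings n \<and>
    (\<forall>A \<in> antichains (n - 1).
       AST n A = (Match \<circ> RSK_hat n \<circ> inv_into (Av321 n) Exc) A)"
proof -
  have "AST n A \<in> noncrossing_matchings n \<and> AST n A = Match (RSK_hat n (inv_into (Av321 n) Exc A))"
    if A: "A \<in> antichains (n - 1)" for A
  proof -
    have mem: "A \<in> Exc ` Av321 n" using Exc_surj[OF A] by blast
    \<comment> \<open>The results on a single permutation apply to the chosen preimage, whose image
      under \<open>Exc\<close> is \<open>A\<close>.\<close>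
    interpret perm321 n "inv_into (Av321 n) Exc A"
      by unfold_locales (rule inv_into_into[OF mem])
    show ?thesis using AST_Exc[OF assms] f_inv_into_f[OF mem] by simp
  qed
  then show ?thesis unfolding Pi_iff comp_def by blast
qed

end
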